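(* Let $\theta\in[-1,0]$ and $\xi\in(0,1)$. Then $$\lim_{n\to\infty}\frac1n\log p_n^{\theta,\xi}=\log\left(\frac{\sqrt{\xi(1-\xi)}}{\arctan_{-\theta}\bigl(\sqrt{\tfrac{\xi}{1-\xi}}\bigr)}\right).$$ Moreover, the analogous result holds for $\theta<-1$: in this case $$\lim_{n\to\infty}\frac1n\log p_n^{\theta,\xi}=\log\left(\frac{\sqrt{\xi(1-\xi)}}{\arctan_{-1/\theta}\bigl(\sqrt{\tfrac{\xi}{1-\xi}}\bigr)}\right).$$
   Context: Let $(X_i)_{i\ge 0}$ be i.i.d. real random variables with density $\xi e^{x}\mathbf 1_{x<0}+(1-\xi)e^{-x}\mathbf 1_{x>0}$, $x\in\mathbb{R}$. For $\theta\in\mathbb{R}$ and $n\ge1$ put $$p_n^{\theta,\xi}:=\mathbb{P}(X_1>\theta X_0,\ X_2>\theta X_1,\ \ldots,\ X_n>\theta X_{n-1}).$$ For $q>0$ let $[n]_q!:=\prod_{k=1}^n\frac{1-q^k}{1-q}$ with $[n]_1!=n!$, and $e_q(z):=\sum_{n\ge0}\frac{z^n}{[n]_q!}$, $\cos_q(z):=\sum_{n\ge0}\frac{(-1)^nz^{2n}}{[2n]_q!}=\frac12(e_q(iz)+e_q(-iz))$, $\sin_q(z):=\sum_{n\ge0}\frac{(-1)^nz^{2n+1}}{[2n+1]_q!}=\frac1{2i}(e_q(iz)-e_q(-iz))$. For $0<q<1$ these series converge for $|z|<\frac1{1-q}$, and outside this disk the functions are understood through the meromorphic continuation $e_q(z)=\prod_{j=0}^\infty\frac{1}{1-(1-q)zq^j}$,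 so that $\sin_q,\cos_q$ are defined on all of $\mathbb{R}$. Put $\tan_q:=\sin_q/\cos_q$. For $0<q\le1$, let $z_0(q)$ be the smallest positive real zero of $\cos_q$; $\tan_q$ is a strictly increasing bijection from $[0,z_0(q))$ onto $[0,\infty)$, and $\arctan_q:[0,\infty)\to[0,z_0(q))$ denotes its inverse (so $\arctan_1=\arctan$). For $q=0$, $\tan_0$ is the identity function (the limit of $\tan_q$ as $q\to0$), and $\arctan_0(x)=x$. One has $\tan_{1/q}=\tan_q$ as power series. *)

theory Defs
  imports "HOL-Probability.Probability"
begin

definition asym_laplace_density :: "real \<Rightarrow> real \<Rightarrow> real" where
  "asym_laplace_density \<xi> x =
     \<xi> * exp x * indicator {..<0} x + (1 - \<xi>) * exp (- x) * indicator {0<..} x"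

definition persistence_prob :: "'a measure \<Rightarrow> (nat \<Rightarrow> 'a \<Rightarrow> real) \<Rightarrow> real \<Rightarrow> nat \<Rightarrow> real" where
  "persistence_prob M X \<theta> n =
     measure M {\<omega> \<in> space M. \<forall>k<n. X (Suc k) \<omega> > \<theta> * X k \<omega>}"

definition qfact :: "real \<Rightarrow> nat \<Rightarrow> real" where
  "qfact q n = (if q = 1 then fact n else (\<Prod>k=1..n. (1 - q ^ k) / (1 - q)))"

text \<open>
  The function \<open>e\<^sub>q\<close> for \<open>q > 0\<close>. For \<open>q < 1\<close> the series converges only in the open disk of
  radius \<open>1 / (1 - q)\<close>; elsewhere the product gives the meromorphic continuation. Its poles
  \<open>z = 1 / ((1 - q) q^j)\<close> are real and positive, so (with the totalised value \<open>0\<close> there) they play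
  no role for \<open>e\<^sub>q (\<plusminus> i x)\<close> with \<open>x\<close> real.
\<close>
definition qexp :: "real \<Rightarrow> complex \<Rightarrow> complex" where
  "qexp q z =
     (if q < 1 \<and> 1 / (1 - q) \<le> norm z
      then (\<Prod>j. 1 / (1 - (1 - of_real q) * z * of_real q ^ j))
      else (\<Sum>n. z ^ n / of_real (qfact q n)))"

definition qcos :: "real \<Rightarrow> complex \<Rightarrow> complex" where
  "qcos q z = (qexp q (\<i> * z) + qexp q (- \<i> * z)) / 2"

definition qsin :: "real \<Rightarrow> complex \<Rightarrow> complex" where
  "qsin q z = (qexp q (\<i> * z) - qexp q (- \<i> * z)) / (2 * \<i>)"

definition qtan :: "real \<Rightarrow> complex \<Rightarrow> complex" where
  "qtan q z = qsin q z / qcos q z"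

text \<open>The smallest positive real zero of \<open>cos\<^sub>q\<close>, meaningful for \<open>0 < q \<le> 1\<close>.\<close>
definition qcos_zero :: "real \<Rightarrow> real" where
  "qcos_zero q = (LEAST x. 0 < x \<and> qcos q (of_real x) = 0)"

text \<open>
  The inverse of \<open>tan\<^sub>q\<close> (which is real on the real axis) restricted to \<open>[0, z\<^sub>0(q))\<close>, with
  \<open>tan\<^sub>0\<close> taken to be the identity; meaningful for \<open>0 \<le> q \<le> 1\<close> and \<open>y \<ge> 0\<close>.
\<close>
definition qarctan :: "real \<Rightarrow> real \<Rightarrow> real" where
  "qarctan q y =
     (if q = 0 then y
      else the_inv_into {0..<qcos_zero q} (\<lambda>x. qtan q (of_real x)) (of_real y))"

lemma qexp_sums:
  assumes "0 < q" "q \<le> 1" "q < 1 \<Longrightarrow> norm z < 1 / (1 - q)"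
  shows "(\<lambda>n. z ^ n / of_real (qfact q n)) sums qexp q z"
proof (cases "q = 1")
  case True
  have "(\<lambda>n. z ^ n / of_real (fact n)) sums exp z"
    using exp_converges[of z] by (simp add: scaleR_conv_of_real field_simps)
  then show ?thesis using True by (auto simp: qexp_def qfact_def sums_iff)
next
  case False
  then have q: "0 < q" "q < 1" using assms by auto
  let ?f = "\<lambda>n. z ^ n / of_real (qfact q n)"
  define r where "r n = norm z * (1 - q) / (1 - q ^ Suc n)" for n
  have step: "norm (?f (Suc n)) = r n * norm (?f n)" for n
  proof -
    have "q ^ Suc n < 1" using q power_Suc_less_one by blast
    moreover have "qfact q (Suc n) = qfact q n * ((1 - q ^ Suc n) / (1 - q))"
      using q by (simp add: qfact_def)
    ultimately have "norm (qfact q (Suc n)) = norm (qfact q n) * ((1 - q ^ Suc n) / (1 - q))"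
      using q by (simp add: abs_mult del: power_Suc)
    then show ?thesis
      by (simp add: r_def norm_mult norm_divide norm_power mult_ac)
  qed
  have "(\<lambda>n. q ^ Suc n) \<longlonglongrightarrow> 0"
    using q by (intro LIMSEQ_Suc LIMSEQ_realpow_zero) auto
  then have lim: "r \<longlonglongrightarrow> norm z * (1 - q) / (1 - 0)"
    unfolding r_def by (intro tendsto_intros) auto
  have lt: "norm z * (1 - q) < 1" using assms(3) q by (simp add: field_simps)
  then obtain c where c: "norm z * (1 - q) < c" "c < 1" using dense by blast
  then have "\<forall>\<^sub>F n in sequentially. r n < c" using lim by (auto dest: order_tendstoD)
  then obtain N where N: "\<And>n. n \<ge> N \<Longrightarrow> r n < c" by (auto simp: eventually_sequentially)
  have "summable ?f"
  proof (rule summable_ratio_test[OF c(2), of N])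
    fix n assume "N \<le> n"
    then show "norm (?f (Suc n)) \<le> c * norm (?f n)"
      unfolding step by (intro mult_right_mono less_imp_le[OF N]) auto
  qed
  then show ?thesis using assms(3) q by (auto simp: qexp_def summable_sums)
qed

lemma qcos_sums:
  assumes "0 < q" "q \<le> 1" "q < 1 \<Longrightarrow> norm z < 1 / (1 - q)"
  shows "(\<lambda>n. (-1) ^ n * z ^ (2 * n) / of_real (qfact q (2 * n))) sums qcos q z"
proof -
  define g where "g n = ((\<i> * z) ^ n / of_real (qfact q n) + (- \<i> * z) ^ n / of_real (qfact q n)) / 2" for n
  have "g sums qcos q z"
    unfolding qcos_def g_def using assms
    by (intro sums_divide sums_add qexp_sums) (auto simp: norm_mult)
  moreover have "g n = 0" if "odd n" for n
    using that by (simp add: g_def power_mult_distrib)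
  ultimately have "(\<lambda>n. g (2 * n)) sums qcos q z"
    using sums_mono_reindex[of "\<lambda>n. 2 * n" g "qcos q z"]
    by (force simp: strict_mono_def elim!: evenE)
  moreover have "g (2 * n) = (-1) ^ n * z ^ (2 * n) / of_real (qfact q (2 * n))" for n
    by (simp add: g_def power_mult_distrib power_mult flip: power_minus[of "z\<^sup>2"])
  ultimately show ?thesis by simp
qed

lemma qsin_sums:
  assumes "0 < q" "q \<le> 1" "q < 1 \<Longrightarrow> norm z < 1 / (1 - q)"
  shows "(\<lambda>n. (-1) ^ n * z ^ (2 * n + 1) / of_real (qfact q (2 * n + 1))) sums qsin q z"
proof -
  define g where "g n = ((\<i> * z) ^ n / of_real (qfact q n) - (- \<i> * z) ^ n / of_real (qfact q n)) / (2 * \<i>)" for n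
  have "g sums qsin q z"
    unfolding qsin_def g_def using assms
    by (intro sums_divide sums_diff qexp_sums) (auto simp: norm_mult)
  moreover have "g n = 0" if "even n" for n
    using that by (simp add: g_def power_mult_distrib)
  ultimately have "(\<lambda>n. g (2 * n + 1)) sums qsin q z"
    using sums_mono_reindex[of "\<lambda>n. 2 * n + 1" g "qsin q z"]
    by (force simp: strict_mono_def elim!: oddE)
  moreover have "g (2 * n + 1) = (-1) ^ n * z ^ (2 * n + 1) / of_real (qfact q (2 * n + 1))" for n
    by (simp add: g_def power_mult_distrib power_mult flip: power_minus[of "z\<^sup>2"])
  ultimately show ?thesis by simp
qed

lemma qexp_1: "qexp 1 z = exp z"
  using qexp_sums[of 1 z] exp_converges[of z]
  by (auto simp: qfact_def scaleR_conv_of_real field_simps dest: sums_unique2)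

lemma qtan_1: "qtan 1 z = tan z"
  by (simp add: qtan_def qsin_def qcos_def qexp_1 tan_def sin_exp_eq cos_exp_eq)

lemma qcos_zero_1: "qcos_zero 1 = pi / 2"
  unfolding qcos_zero_def
proof (rule Least_equality)
  have *: "qcos 1 (of_real x) = of_real (cos x)" for x
    by (simp add: qcos_def qexp_1 cos_exp_eq flip: cos_of_real)
  show "0 < pi / 2 \<and> qcos 1 (of_real (pi / 2)) = 0"
    by (simp only: *) simp
  show "pi / 2 \<le> x" if "0 < x \<and> qcos 1 (of_real x) = 0" for x
    using that cos_gt_zero[of x] by (fastforce simp: *)
qed

lemma qarctan_1:
  assumes "y \<ge> 0"
  shows "qarctan 1 y = arctan y"
proof -
  have tan: "qtan 1 (of_real x) = of_real (tan x)" for x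
    by (simp add: qtan_1 tan_of_real)
  have inj: "inj_on (\<lambda>x. qtan 1 (of_real x)) {0..<pi / 2}"
  proof (rule inj_onI)
    fix x y assume "x \<in> {0..<pi / 2}" "y \<in> {0..<pi / 2}"
      "qtan 1 (complex_of_real x) = qtan 1 (of_real y)"
    then show "x = y" unfolding tan
      by (metis arctan_tan atLeastLessThan_iff less_le_trans minus_pi_half_less_zero of_real_eq_iff)
  qed
  show ?thesis
    using the_inv_into_f_eq[OF inj, of "arctan y" "of_real y"] assms arctan_ubound[of y]
    by (simp add: qarctan_def qcos_zero_1 tan tan_arctan)
qed

end

theory Submission
  imports Defs
begin

text \<open>
  For \<open>q = - \<theta> \<in> [0, 1]\<close> the operator integrating out the last variable has a positive
  bounded eigenfunction, explicitly computable from \<open>cos\<^sub>q\<close> and \<open>sin\<^sub>q\<close>. With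
  \<open>t = sqrt (\<xi> / (1 - \<xi>))\<close>, eigenvalue \<open>sqrt (\<xi> (1 - \<xi>)) / w\<close>, and the eigenfunction written
  as \<open>x \<mapsto> F (q x)\<close> for \<open>x \<ge> 0\<close> and \<open>x \<mapsto> S (- q x) / t\<close> for \<open>x < 0\<close>, the eigenvalue equation
  becomes \<open>F' y = w exp (- y) S (q y)\<close>, \<open>S' y = - w exp (- y) F (q y)\<close>, \<open>S (\<infinity>) = 0\<close> and
  \<open>S 0 = t F 0\<close>. For \<open>0 < q < 1\<close> a solution is the Poisson mean, with parameter \<open>y / (1 - q)\<close>, of
  \<open>cos\<^sub>q (w q^m)\<close> and \<open>sin\<^sub>q (w q^m)\<close>: the system reduces to
  \<open>e\<^sub>q (q z) = (1 - (1 - q) z) e\<^sub>q z\<close>, and the boundary condition at \<open>0\<close> to \<open>tan\<^sub>q w = t\<close>. This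
  form, unlike the power series in \<open>w\<close>, also covers \<open>w \<ge> 1 / (1 - q)\<close> and is visibly positive.
  Comparing the constant function with the eigenfunction bounds \<open>p\<^sub>n\<close> above and below by multiples
  of the \<open>n\<close>-th power of the eigenvalue. The case \<open>\<theta> < -1\<close> follows by reversing time.
\<close>

subsection \<open>Persistence probabilities as iterated integrals\<close>

text \<open>The transition operator of the i.i.d. chain, killed as soon as a step from x to y fails
  y > \<theta> x. Working in \<open>ennreal\<close> keeps iterates free of integrability
  conditions.\<close>

definition survival_op :: "real measure \<Rightarrow> real \<Rightarrow> (real \<Rightarrow> ennreal) \<Rightarrow> real \<Rightarrow> ennreal" where
  "survival_op \<mu> \<theta> h x = (\<integral>\<^sup>+ y. h y * indicator {\<theta> * x<..} y \<partial>\<mu>)"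

lemma measurable_survival_op:
  assumes "sigma_finite_measure \<mu>" and [measurable_cong]: "sets \<mu> = sets borel"
    and [measurable]: "h \<in> borel_measurable borel"
  shows "survival_op \<mu> \<theta> h \<in> borel_measurable borel"
proof -
  interpret sigma_finite_measure \<mu> by fact
  have [measurable]: "(\<lambda>(x, y). h y * (if \<theta> * x < y then 1 else 0)) \<in> borel_measurable (borel \<Otimes>\<^sub>M \<mu>)"
    by measurable
  have "(\<lambda>x. \<integral>\<^sup>+ y. h y * (if \<theta> * x < y then 1 else 0) \<partial>\<mu>) \<in> borel_measurable borel"
    by measurable
  then show ?thesis
    by (simp add: survival_op_def[abs_def] indicator_def)
qed

lemma survival_op_mono:
  assumes "\<And>x. f x \<le> g x"
  shows "survival_op \<mu> \<theta> f x \<le> survival_op \<mu> \<theta> g x"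
  unfolding survival_op_def by (intro nn_integral_mono mult_right_mono assms) auto

lemma survival_op_cmult:
  assumes [measurable_cong]: "sets \<mu> = sets borel" and [measurable]: "h \<in> borel_measurable borel"
  shows "survival_op \<mu> \<theta> (\<lambda>x. c * h x) x = c * survival_op \<mu> \<theta> h x"
  unfolding survival_op_def by (subst nn_integral_cmult[symmetric]) (auto simp: mult.assoc)

text \<open>Integrating out the last coordinate replaces h by \<open>survival_op\<close> applied to
  h and shortens the chain by one step. The induction therefore has to range over all h, although
  only the constant 1 is used later.\<close>

lemma nn_integral_PiM_survival_op:
  assumes "prob_space \<mu>" and sets [measurable_cong]: "sets \<mu> = sets borel"
    and "h \<in> borel_measurable borel"
  shows "(\<integral>\<^sup>+ x. indicator {x. \<forall>k<n. x (Suc k) > \<theta> * x k} x * h (x n) \<partial>PiM {..n} (\<lambda>_. \<mu>))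
       = (\<integral>\<^sup>+ x. (survival_op \<mu> \<theta> ^^ n) h x \<partial>\<mu>)"
  using assms(3)
proof (induction n arbitrary: h)
  interpret prob_space \<mu> by fact
  interpret product_sigma_finite "\<lambda>_ :: nat. \<mu>" by standard
  case (0 h)
  then show ?case
    by (simp add: product_nn_integral_singleton)
next
  interpret prob_space \<mu> by fact
  interpret product_sigma_finite "\<lambda>_ :: nat. \<mu>" by standard
  case (Suc n h)
  note [measurable] = Suc.prems
  have [measurable]: "survival_op \<mu> \<theta> h \<in> borel_measurable borel"
    by (intro measurable_survival_op sets Suc.prems) standard
  have ins: "{..Suc n} = insert (Suc n) {..n}" by auto
  let ?I = "\<lambda>n x. indicator {x. \<forall>k<n. x (Suc k) > \<theta> * x k} x :: ennreal"
  have I_eq: "?I m = (\<lambda>x. if \<forall>k<m. x (Suc k) > \<theta> * x k then 1 else 0)" for m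
    by (auto simp: fun_eq_iff indicator_def)
  \<comment> \<open>The new coordinate enters a single constraint, the last one, so the indicator
    factors.\<close>
  have upd: "?I (Suc n) (x(Suc n := y)) = ?I n x * indicator {\<theta> * x n<..} y" for x y
    by (auto simp: indicator_def less_Suc_eq)
  have m: "(\<lambda>x. ?I (Suc n) x * h (x (Suc n))) \<in> borel_measurable (PiM {..Suc n} (\<lambda>_. \<mu>))"
  proof -
    have [measurable]: "(\<lambda>x. x k) \<in> borel_measurable (PiM {..Suc n} (\<lambda>_. \<mu>))" if "k \<le> Suc n" for k
      using measurable_component_singleton[of k "{..Suc n}" "\<lambda>_. \<mu>"] that
      by (auto cong: measurable_cong_sets simp: sets)
    show ?thesis unfolding I_eq by measurable
  qed
  have "(\<integral>\<^sup>+ x. ?I (Suc n) x * h (x (Suc n)) \<partial>PiM {..Suc n} (\<lambda>_. \<mu>))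
      = (\<integral>\<^sup>+ x. (\<integral>\<^sup>+ y. ?I (Suc n) (x(Suc n := y)) * h y \<partial>\<mu>) \<partial>PiM {..n} (\<lambda>_. \<mu>))"
    using product_nn_integral_insert[OF finite_atMost _ m[unfolded ins]] unfolding ins
    by simp
  also have "\<dots> = (\<integral>\<^sup>+ x. ?I n x * survival_op \<mu> \<theta> h (x n) \<partial>PiM {..n} (\<lambda>_. \<mu>))"
  proof (intro nn_integral_cong)
    fix x
    have "(\<integral>\<^sup>+ y. ?I n x * (h y * indicator {\<theta> * x n<..} y) \<partial>\<mu>) = ?I n x * survival_op \<mu> \<theta> h (x n)"
      unfolding survival_op_def by (intro nn_integral_cmult borel_measurable_times) simp_all
    then show "(\<integral>\<^sup>+ y. ?I (Suc n) (x(Suc n := y)) * h y \<partial>\<mu>) = ?I n x * survival_op \<mu> \<theta> h (x n)"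
      unfolding upd by (simp only: mult_ac)
  qed
  also have "\<dots> = (\<integral>\<^sup>+ x. (survival_op \<mu> \<theta> ^^ n) (survival_op \<mu> \<theta> h) x \<partial>\<mu>)"
    by (rule Suc.IH) measurable
  finally show ?case by (simp only: funpow_Suc_right comp_def)
qed

text \<open>By independence the joint law of X 0, ..., X n is the product measure, where the
  iterated integral applies. Only the finite segment \<open>{..n}\<close> is involved, which lets
  the lemma serve a time-reversed segment as well.\<close>

lemma emeasure_persistence:
  assumes "prob_space M" and indep: "prob_space.indep_vars M (\<lambda>_. borel) X {..n}"
    and distr: "\<And>i. i \<le> n \<Longrightarrow> distr M borel (X i) = \<mu>"
  shows "emeasure M {\<omega> \<in> space M. \<forall>k<n. X (Suc k) \<omega> > \<theta> * X k \<omega>}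
       = (\<integral>\<^sup>+ x. (survival_op \<mu> \<theta> ^^ n) (\<lambda>_. 1) x \<partial>\<mu>)"
proof -
  interpret prob_space M by fact
  have rv [measurable]: "X i \<in> borel_measurable M" if "i \<le> n" for i
    using indep that by (auto simp: indep_vars_def)
  have \<mu>: "prob_space \<mu>" "sets \<mu> = sets borel"
    using distr[of 0] prob_space_distr[OF rv[of 0]] by auto
  have ev: "{\<omega> \<in> space M. \<forall>k<n. X (Suc k) \<omega> > \<theta> * X k \<omega>} \<in> sets M"
    by measurable
  let ?S = "{x :: nat \<Rightarrow> real. \<forall>k<n. x (Suc k) > \<theta> * x k}"
  have "distr M (PiM {..n} (\<lambda>_. borel)) (\<lambda>\<omega>. \<lambda>i\<in>{..n}. X i \<omega>) = PiM {..n} (\<lambda>i. distr M borel (X i))"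
    using indep by (subst (asm) indep_vars_iff_distr_eq_PiM') auto
  also have "\<dots> = PiM {..n} (\<lambda>_. \<mu>)"
    by (intro PiM_cong) (auto simp: distr)
  finally have D: "PiM {..n} (\<lambda>_. \<mu>) = distr M (PiM {..n} (\<lambda>_. borel)) (\<lambda>\<omega>. \<lambda>i\<in>{..n}. X i \<omega>)" ..
  have [measurable]: "(\<lambda>x. indicator ?S x :: ennreal) \<in> borel_measurable (PiM {..n} (\<lambda>_. borel))"
  proof -
    have [measurable]: "(\<lambda>x. x k) \<in> borel_measurable (PiM {..n} (\<lambda>_. borel :: real measure))" if "k \<le> n" for k
      using measurable_component_singleton[of k "{..n}" "\<lambda>_. borel"] that by auto
    have "(\<lambda>x. if \<forall>k<n. x (Suc k) > \<theta> * x k then 1 else 0 :: ennreal)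
        \<in> borel_measurable (PiM {..n} (\<lambda>_. borel :: real measure))"
      by measurable
    then show ?thesis by (simp add: indicator_def)
  qed
  have "(\<integral>\<^sup>+ x. (survival_op \<mu> \<theta> ^^ n) (\<lambda>_. 1) x \<partial>\<mu>) = (\<integral>\<^sup>+ x. indicator ?S x \<partial>PiM {..n} (\<lambda>_. \<mu>))"
    using nn_integral_PiM_survival_op[OF \<mu>, of "\<lambda>_. 1"] by simp
  also have "\<dots> = (\<integral>\<^sup>+ \<omega>. indicator ?S (\<lambda>i\<in>{..n}. X i \<omega>) \<partial>M)"
    unfolding D by (subst nn_integral_distr) auto
  also have "\<dots> = (\<integral>\<^sup>+ \<omega>. indicator {\<omega> \<in> space M. \<forall>k<n. X (Suc k) \<omega> > \<theta> * X k \<omega>} \<omega> \<partial>M)"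
    by (intro nn_integral_cong) (auto simp: indicator_def)
  also have "\<dots> = emeasure M {\<omega> \<in> space M. \<forall>k<n. X (Suc k) \<omega> > \<theta> * X k \<omega>}"
    using ev by (rule nn_integral_indicator)
  finally show ?thesis ..
qed

text \<open>Meant for the reversal k to n - k, which is injective on \<open>{..n}\<close> but, with
  truncated subtraction, not on all naturals. Each finite subfamily indexed by J is carried along f
  to one indexed by I, where the product formula is known.\<close>

lemma (in prob_space) indep_vars_reindex:
  assumes X: "indep_vars N X I" and f: "inj_on f J" "f ` J \<subseteq> I"
  shows "indep_vars (N \<circ> f) (X \<circ> f) J"
proof -
  let ?F = "\<lambda>i. {X i -` B \<inter> space M |B. B \<in> sets (N i)}"
  have rv: "\<And>i. i \<in> I \<Longrightarrow> random_variable (N i) (X i)" and indep: "indep_sets ?F I"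
    using X by (auto simp: indep_vars_def2)
  have "indep_sets (\<lambda>j. ?F (f j)) J"
  proof (rule indep_setsI)
    show "?F (f j) \<subseteq> events" if "j \<in> J" for j
      using rv[of "f j"] f(2) that by (blast intro: measurable_sets)
  next
    fix A K assume K: "K \<noteq> {}" "K \<subseteq> J" "finite K" and A: "\<forall>j\<in>K. A j \<in> ?F (f j)"
    have inj: "inj_on f K" using f(1) K(2) by (rule inj_on_subset)
    let ?g = "the_inv_into K f"
    have g: "?g (f k) = k" if "k \<in> K" for k
      using inj that by (rule the_inv_into_f_f)
    have A': "\<forall>i\<in>f ` K. A (?g i) \<in> ?F i"
    proof
      fix i assume "i \<in> f ` K"
      then obtain k where k: "i = f k" "k \<in> K" by blast
      show "A (?g i) \<in> ?F i"
        unfolding k(1) g[OF k(2)] using A k(2) by (rule bspec)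
    qed
    have "prob (\<Inter>i\<in>f ` K. A (?g i)) = (\<Prod>i\<in>f ` K. prob (A (?g i)))"
      using f(2) K by (intro indep_setsD[OF indep _ _ _ A']) blast+
    also have "\<dots> = (\<Prod>j\<in>K. prob (A j))"
      unfolding prod.reindex[OF inj] by (intro prod.cong) (simp_all add: g)
    also have "(\<Inter>i\<in>f ` K. A (?g i)) = (\<Inter>j\<in>K. A j)"
      by (simp add: g)
    finally show "prob (\<Inter>j\<in>K. A j) = (\<Prod>j\<in>K. prob (A j))" .
  qed
  then show ?thesis
    using rv f(2) by (auto simp: indep_vars_def2)
qed

section \<open>Growth rate from a positive eigenfunction\<close>

text \<open>Multiplicative constants disappear after dividing the logarithm by n, and so does the
  index shift in the upper bound, which costs one factor l. The shift is there because the
  comparison in \<open>persistence_rate\<close> holds only after one application of the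
  operator.\<close>

lemma log_growth_rate:
  fixes p :: "nat \<Rightarrow> real"
  assumes "0 < a" "0 < l" and lower: "\<And>n. a * l ^ n \<le> p n" and upper: "\<And>n. p (Suc n) \<le> b * l ^ n"
  shows "(\<lambda>n. 1 / real n * ln (p n)) \<longlonglongrightarrow> ln l"
proof -
  have p: "0 < p n" for n
    using lower[of n] assms(1,2) by (intro less_le_trans[OF _ lower]) auto
  have b: "0 < b"
    using less_le_trans[OF p[of 1] upper[of 0, folded One_nat_def]] by simp
  have lim: "(\<lambda>n. c / real n + ln l) \<longlonglongrightarrow> ln l" for c
    using tendsto_add[OF real_tendsto_divide_at_top[OF tendsto_const filterlim_real_sequentially] tendsto_const, of c "ln l"]
    by simp
  have lo: "\<forall>\<^sub>F n in sequentially. ln a / real n + ln l \<le> 1 / real n * ln (p n)"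
    using eventually_gt_at_top[of 0]
  proof eventually_elim
    case (elim n)
    have "ln a + real n * ln l = ln (a * l ^ n)"
      using assms by (simp add: ln_mult ln_realpow)
    also have "\<dots> \<le> ln (p n)"
      using assms(1,2) p by (intro ln_mono lower) auto
    finally have "(ln a + real n * ln l) / real n \<le> ln (p n) / real n"
      by (rule divide_right_mono) simp
    then show ?case using elim by (simp add: add_divide_distrib)
  qed
  have up: "\<forall>\<^sub>F n in sequentially. 1 / real n * ln (p n) \<le> (ln b - ln l) / real n + ln l"
    using eventually_gt_at_top[of 0]
  proof eventually_elim
    case (elim n)
    then obtain m where m: "n = Suc m" by (cases n) auto
    have "ln (p n) \<le> ln (b * l ^ m)"
      unfolding m using p by (intro ln_mono upper) auto
    also have "\<dots> = ln b + real m * ln l"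
      using b assms by (simp add: ln_mult ln_realpow)
    also have "\<dots> = ln b - ln l + real n * ln l"
      unfolding m by (simp add: algebra_simps)
    finally have "ln (p n) / real n \<le> (ln b - ln l + real n * ln l) / real n"
      by (rule divide_right_mono) simp
    then show ?case using elim by (simp add: add_divide_distrib)
  qed
  show ?thesis
    by (rule tendsto_sandwich[OF lo up lim lim])
qed

lemma survival_op_funpow_mono:
  assumes "\<And>x. f x \<le> g x"
  shows "(survival_op \<mu> \<theta> ^^ n) f x \<le> (survival_op \<mu> \<theta> ^^ n) g x"
  by (induction n arbitrary: x) (auto intro: survival_op_mono assms)

lemma survival_op_funpow_eigenfunction:
  assumes "sets \<mu> = sets borel" "h \<in> borel_measurable borel" "\<And>x. survival_op \<mu> \<theta> h x = l * h x"
  shows "(survival_op \<mu> \<theta> ^^ n) (\<lambda>x. c * h x) x = c * l ^ n * h x"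
proof (induction n arbitrary: x)
  case (Suc n)
  have "(survival_op \<mu> \<theta> ^^ n) (\<lambda>x. c * h x) = (\<lambda>x. c * l ^ n * h x)"
    using Suc.IH by blast
  then have "(survival_op \<mu> \<theta> ^^ Suc n) (\<lambda>x. c * h x) x = survival_op \<mu> \<theta> (\<lambda>x. c * l ^ n * h x) x"
    by (simp only: funpow.simps comp_def)
  also have "\<dots> = c * l ^ n * (l * h x)"
    using assms(1,2) by (simp only: survival_op_cmult assms(3))
  finally show ?case by (simp only: power_Suc mult_ac)
qed simp

text \<open>Monotonicity of the operator sandwiches the iterates of 1: from below 1 >= h / B, from
  above the first iterate is at most C h. Domination is asked of the first iterate, not of 1 itself,
  because an eigenfunction may tend to 0 at minus infinity.\<close>

lemma persistence_rate:
  fixes \<mu> :: "real measure"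
  assumes "prob_space \<mu>" and sets: "sets \<mu> = sets borel"
    and h [measurable]: "h \<in> borel_measurable borel" and pos: "\<And>x. 0 < h x"
    and bounded: "\<And>x. h x \<le> ennreal B" and eigen: "\<And>x. survival_op \<mu> \<theta> h x = ennreal l * h x"
    and dominate: "\<And>x. survival_op \<mu> \<theta> (\<lambda>_. 1) x \<le> ennreal C * h x"
    and "0 < l" "0 < B" "0 < C" and p: "\<And>n. 0 \<le> p n"
    and p_eq: "\<And>n. ennreal (p n) = (\<integral>\<^sup>+ x. (survival_op \<mu> \<theta> ^^ n) (\<lambda>_. 1) x \<partial>\<mu>)"
  shows "(\<lambda>n. 1 / real n * ln (p n)) \<longlonglongrightarrow> ln l"
proof -
  interpret prob_space \<mu> by fact
  note [measurable_cong] = sets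
  have "(\<integral>\<^sup>+ x. h x \<partial>\<mu>) \<le> (\<integral>\<^sup>+ x. ennreal B \<partial>\<mu>)"
    by (intro nn_integral_mono bounded)
  also have "\<dots> < \<infinity>" by (simp add: emeasure_space_1)
  finally obtain i where i: "0 \<le> i" "(\<integral>\<^sup>+ x. h x \<partial>\<mu>) = ennreal i"
    by (cases "\<integral>\<^sup>+ x. h x \<partial>\<mu>") auto
  have "(\<integral>\<^sup>+ x. h x \<partial>\<mu>) \<noteq> 0"
  proof
    assume "(\<integral>\<^sup>+ x. h x \<partial>\<mu>) = 0"
    then have "AE x in \<mu>. h x = 0"
      by (subst (asm) nn_integral_0_iff_AE) auto
    then have "AE x in \<mu>. False"
      by (rule eventually_mono) (metis pos less_irrefl)
    then show False by simp
  qed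
  then have "0 < i" using i by (cases "i = 0") auto
  \<comment> \<open>Used with c = 1 / B for the lower bound and c = C for the upper one.\<close>
  have int: "(\<integral>\<^sup>+ x. (survival_op \<mu> \<theta> ^^ n) (\<lambda>x. ennreal c * h x) x \<partial>\<mu>) = ennreal (c * l ^ n * i)"
    if "0 < c" for c n
  proof -
    have "(\<integral>\<^sup>+ x. (survival_op \<mu> \<theta> ^^ n) (\<lambda>x. ennreal c * h x) x \<partial>\<mu>)
        = (\<integral>\<^sup>+ x. ennreal c * ennreal l ^ n * h x \<partial>\<mu>)"
      by (simp only: survival_op_funpow_eigenfunction[OF sets h eigen])
    also have "\<dots> = ennreal c * ennreal l ^ n * ennreal i"
      by (subst nn_integral_cmult) (auto simp: i)
    finally show ?thesis
      using \<open>0 < l\<close> that i by (simp add: ennreal_mult ennreal_power)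
  qed
  show ?thesis
  proof (rule log_growth_rate)
    fix n
    have B: "0 < 1 / B" using \<open>0 < B\<close> by simp
    have "ennreal (1 / B * l ^ n * i) \<le> ennreal (p n)"
      unfolding p_eq int[OF B, symmetric]
    proof (intro nn_integral_mono survival_op_funpow_mono)
      fix x
      have "ennreal (1 / B) * h x \<le> ennreal (1 / B) * ennreal B"
        by (intro mult_left_mono bounded) simp
      also have "\<dots> = 1"
        using \<open>0 < B\<close> by (simp flip: ennreal_mult)
      finally show "ennreal (1 / B) * h x \<le> 1" .
    qed
    then show "i / B * l ^ n \<le> p n"
      using p by (simp add: mult_ac)
    have "ennreal (p (Suc n)) \<le> ennreal (C * l ^ n * i)"
      unfolding p_eq int[OF \<open>0 < C\<close>, symmetric] funpow_Suc_right comp_def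
      by (intro nn_integral_mono survival_op_funpow_mono dominate)
    then show "p (Suc n) \<le> C * i * l ^ n"
      using \<open>0 < C\<close> \<open>0 < l\<close> i by (simp add: mult_ac)
  qed (use \<open>0 < l\<close> \<open>0 < B\<close> \<open>0 < i\<close> in auto)
qed


subsection \<open>The eigenvalue equation\<close>

definition asym_laplace :: "real \<Rightarrow> real measure" where
  "asym_laplace \<xi> = density lborel (\<lambda>x. ennreal (asym_laplace_density \<xi> x))"

lemma borel_measurable_asym_laplace_density [measurable]:
  "asym_laplace_density \<xi> \<in> borel_measurable borel"
  unfolding asym_laplace_density_def by measurable

lemma sets_asym_laplace [simp, measurable_cong]: "sets (asym_laplace \<xi>) = sets borel"
  by (simp add: asym_laplace_def)

text \<open>For q >= 0 both branches are evaluated at q |x|, so only values of F and S on the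
  nonnegative half-line enter. The condition S 0 = t F 0 makes the branches agree at 0.\<close>

definition eigenfunction :: "real \<Rightarrow> real \<Rightarrow> (real \<Rightarrow> real) \<Rightarrow> (real \<Rightarrow> real) \<Rightarrow> real \<Rightarrow> real" where
  "eigenfunction t q F S x = (if x < 0 then S (- q * x) / t else F (q * x))"

text \<open>For x < 0 only y > -q x >= 0 survives, and the integral of the F branch is a value of S
  because S' is a multiple of exp (-y) F (q y). For x >= 0 the negative part of the range gives l (F
  (q x) - F 0) in the same way, and the positive half-line gives l S 0 / t = l F 0, which cancels
  the defect.\<close>

lemma survival_op_eigenfunction:
  fixes F S :: "real \<Rightarrow> real"
  assumes F: "\<And>y. (F has_real_derivative w * exp (- y) * S (q * y)) (at y)"
    and S: "\<And>y. (S has_real_derivative - (w * exp (- y) * F (q * y))) (at y)"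
    and lim: "(S \<longlongrightarrow> 0) at_top" and S0: "S 0 = t * F 0"
    and Fpos: "\<And>y. 0 \<le> y \<Longrightarrow> 0 < F y" and Spos: "\<And>y. 0 \<le> y \<Longrightarrow> 0 < S y"
    and xi: "0 < \<xi>" "\<xi> < 1" and t: "t = sqrt (\<xi> / (1 - \<xi>))"
    and l: "l * w = sqrt (\<xi> * (1 - \<xi>))" and w: "0 < w" and q: "0 \<le> q"
  shows "survival_op (asym_laplace \<xi>) (- q) (\<lambda>y. ennreal (eigenfunction t q F S y)) x
       = ennreal l * ennreal (eigenfunction t q F S x)"
proof -
  have contF: "continuous_on UNIV F" and contS: "continuous_on UNIV S"
    by (intro continuous_at_imp_continuous_on ballI DERIV_isCont, rule F S)+
  have [measurable]: "F \<in> borel_measurable borel" "S \<in> borel_measurable borel"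
    using contF contS by (auto intro: borel_measurable_continuous_onI)
  let ?h = "eigenfunction t q F S"
  let ?\<phi> = "asym_laplace_density \<xi>"
  have t0: "0 < t" using xi t by simp
  have l0: "0 < l" using l w xi zero_less_mult_pos2[of l w] by simp
  have s1: "sqrt (\<xi> * (1 - \<xi>)) = (1 - \<xi>) * t" "sqrt (\<xi> * (1 - \<xi>)) * t = \<xi>"
  proof -
    define a b where "a = sqrt \<xi>" and "b = sqrt (1 - \<xi>)"
    have ab: "\<xi> = a * a" "1 - \<xi> = b * b" "b \<noteq> 0"
      using xi by (simp_all add: a_def b_def)
    have "sqrt (\<xi> * (1 - \<xi>)) = a * b" "t = a / b"
      by (simp_all add: a_def b_def t real_sqrt_mult real_sqrt_divide)
    then show "sqrt (\<xi> * (1 - \<xi>)) = (1 - \<xi>) * t" "sqrt (\<xi> * (1 - \<xi>)) * t = \<xi>"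
      using ab(3) by (simp_all only: ab(2)) (simp_all add: ab(1))
  qed
  \<comment> \<open>The value of t is chosen so that one l matches both weights of the density: this
    makes -(l / t) S y and -l F (-y) antiderivatives of the two integrands below.\<close>
  have s2: "l * w / t = 1 - \<xi>" "l * w * t = \<xi>"
    using s1 t0 by (auto simp: l)
  have [measurable]: "?h \<in> borel_measurable borel"
    unfolding eigenfunction_def[abs_def] by measurable
  have right: "(\<integral>\<^sup>+ y. ennreal ((1 - \<xi>) * exp (- y) * F (q * y)) * indicator {a..} y \<partial>lborel) = ennreal (l * S a / t)"
    if "0 \<le> a" for a
  proof -
    have "((\<lambda>y. - (l / t) * S y) has_real_derivative (1 - \<xi>) * exp (- y) * F (q * y)) (at y)" for y
      unfolding s2(1)[symmetric] by (rule derivative_eq_intros S refl)+ (simp add: field_simps)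
    moreover have "((\<lambda>y. - (l / t) * S y) \<longlongrightarrow> - (l / t) * 0) at_top"
      by (intro tendsto_intros lim)
    ultimately have "(\<integral>\<^sup>+ y. ennreal ((1 - \<xi>) * exp (- y) * F (q * y)) * indicator {a..} y \<partial>lborel)
        = ennreal (- (l / t) * 0 - (- (l / t) * S a))"
      using that xi q by (intro nn_integral_FTC_atLeast) (auto intro!: mult_nonneg_nonneg less_imp_le[OF Fpos])
    then show ?thesis by simp
  qed
  have left: "(\<integral>\<^sup>+ y. ennreal (\<xi> * exp y * (S (- q * y) / t)) * indicator {- a..0} y \<partial>lborel) = ennreal (l * F a - l * F 0)"
    if "0 \<le> a" for a
  proof -
    have "((\<lambda>y. - l * F (- y)) has_real_derivative \<xi> * exp y * (S (- q * y) / t)) (at y)" for y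
      unfolding s2(2)[symmetric] using t0
      by (auto intro!: derivative_eq_intros DERIV_chain2[OF F] simp: field_simps)
    then have "(\<integral>\<^sup>+ y. ennreal (\<xi> * exp y * (S (- q * y) / t)) * indicator {- a..0} y \<partial>lborel)
        = ennreal (- l * F (- 0) - (- l * F (- (- a))))"
      using that xi q t0
      by (intro nn_integral_FTC_Icc) (auto intro!: mult_nonneg_nonneg divide_nonneg_nonneg less_imp_le[OF Spos] mult_nonneg_nonpos)
    then show ?thesis by simp
  qed
  have op: "survival_op (asym_laplace \<xi>) (- q) (\<lambda>y. ennreal (?h y)) x
      = (\<integral>\<^sup>+ y. ennreal (?\<phi> y) * (ennreal (?h y) * indicator {- q * x<..} y) \<partial>lborel)"
    unfolding survival_op_def asym_laplace_def by (subst nn_integral_density) auto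
  show ?thesis
  proof (cases "x < 0")
    case True
    then have a: "0 \<le> - q * x" using q by (simp add: mult_nonneg_nonpos)
    have "AE y in lborel. y \<noteq> - q * x" by (rule AE_lborel_singleton)
    then have "AE y in lborel. ennreal (?\<phi> y) * (ennreal (?h y) * indicator {- q * x<..} y)
        = ennreal ((1 - \<xi>) * exp (- y) * F (q * y)) * indicator {- q * x..} y"
    proof eventually_elim
      case (elim y)
      then show ?case using a xi
        by (auto simp: eigenfunction_def asym_laplace_density_def indicator_def simp flip: ennreal_mult')
    qed
    then have "survival_op (asym_laplace \<xi>) (- q) (\<lambda>y. ennreal (?h y)) x = ennreal (l * S (- q * x) / t)"
      unfolding op right[OF a, symmetric] by (rule nn_integral_cong_AE)
    also have "\<dots> = ennreal l * ennreal (?h x)"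
      using True l0 by (simp add: eigenfunction_def flip: ennreal_mult')
    finally show ?thesis .
  next
    case False
    then have a: "0 \<le> q * x" using q by simp
    \<comment> \<open>Besides the open endpoint, 0 is excluded: the density vanishes there, while
      the two closed ranges below overlap in it.\<close>
    have "AE y in lborel. y \<noteq> - q * x \<and> y \<noteq> 0"
      using AE_lborel_singleton[of "- q * x"] AE_lborel_singleton[of "0::real"] by eventually_elim simp
    then have "AE y in lborel. ennreal (?\<phi> y) * (ennreal (?h y) * indicator {- q * x<..} y)
        = ennreal (\<xi> * exp y * (S (- q * y) / t)) * indicator {- (q * x)..0} y
          + ennreal ((1 - \<xi>) * exp (- y) * F (q * y)) * indicator {0..} y"
    proof eventually_elim
      case (elim y)
      then show ?case using a xi
        by (cases "y < 0") (auto simp: eigenfunction_def asym_laplace_density_def indicator_def simp flip: ennreal_mult')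
    qed
    then have "survival_op (asym_laplace \<xi>) (- q) (\<lambda>y. ennreal (?h y)) x
        = (\<integral>\<^sup>+ y. ennreal (\<xi> * exp y * (S (- q * y) / t)) * indicator {- (q * x)..0} y
          + ennreal ((1 - \<xi>) * exp (- y) * F (q * y)) * indicator {0..} y \<partial>lborel)"
      unfolding op by (rule nn_integral_cong_AE)
    also have "\<dots> = ennreal (l * F (q * x) - l * F 0) + ennreal (l * S 0 / t)"
      unfolding left[OF a, symmetric] right[OF order_refl, symmetric] by (rule nn_integral_add) auto
    also have "\<dots> = ennreal l * ennreal (?h x)"
    proof -
      \<comment> \<open>\<open>ennreal\<close> truncates negative numbers to 0, so adding the two
        summands as reals requires the difference to be nonnegative.\<close>
      have "F 0 \<le> F (q * x)"
      proof (rule DERIV_nonneg_imp_nondecreasing[OF a])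
        fix y :: real assume "0 \<le> y"
        then show "\<exists>D. (F has_real_derivative D) (at y) \<and> 0 \<le> D"
          using w q Spos[of "q * y"] F[of y] by (intro exI[of _ "w * exp (- y) * S (q * y)"]) auto
      qed
      then show ?thesis
        using False l0 t0 Fpos[of 0] by (simp add: S0 eigenfunction_def flip: ennreal_mult' ennreal_plus)
    qed
    finally show ?thesis .
  qed
qed

text \<open>The system and the lower bound on F supply the remaining estimates: S decreases strictly
  to 0, hence is positive and at most S 0, and F is bounded because F' is at most w S 0 exp
  (-y).\<close>

lemma persistence_rate_asym_laplace:
  fixes F S :: "real \<Rightarrow> real"
  assumes F: "\<And>y. (F has_real_derivative w * exp (- y) * S (q * y)) (at y)"
    and S: "\<And>y. (S has_real_derivative - (w * exp (- y) * F (q * y))) (at y)"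
    and lim: "(S \<longlongrightarrow> 0) at_top" and S0: "S 0 = t * F 0"
    and c: "0 < c" and Fc: "\<And>y. 0 \<le> y \<Longrightarrow> c \<le> F y"
    and xi: "0 < \<xi>" "\<xi> < 1" and t: "t = sqrt (\<xi> / (1 - \<xi>))"
    and w: "0 < w" and q: "0 \<le> q"
    and "prob_space (asym_laplace \<xi>)" and p: "\<And>n. 0 \<le> p n"
    and p_eq: "\<And>n. ennreal (p n) = (\<integral>\<^sup>+ x. (survival_op (asym_laplace \<xi>) (- q) ^^ n) (\<lambda>_. 1) x \<partial>asym_laplace \<xi>)"
  shows "(\<lambda>n. 1 / real n * ln (p n)) \<longlonglongrightarrow> ln (sqrt (\<xi> * (1 - \<xi>)) / w)"
proof -
  interpret prob_space "asym_laplace \<xi>" by fact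
  have t0: "0 < t" using xi t by simp
  let ?l = "sqrt (\<xi> * (1 - \<xi>)) / w"
  have l: "?l * w = sqrt (\<xi> * (1 - \<xi>))" "0 < ?l" using w xi by simp_all
  have contF: "continuous_on UNIV F" and contS: "continuous_on UNIV S"
    by (intro continuous_at_imp_continuous_on ballI DERIV_isCont, rule F S)+
  have [measurable]: "F \<in> borel_measurable borel" "S \<in> borel_measurable borel"
    using contF contS by (auto intro: borel_measurable_continuous_onI)
  have Fpos: "0 < F y" if "0 \<le> y" for y
    using Fc[OF that] c by simp
  have Spos: "0 < S y" if "0 \<le> y" for y
  proof (rule DERIV_neg_imp_decreasing_at_top[OF _ lim])
    fix x assume "y \<le> x"
    then show "\<exists>D. (S has_real_derivative D) (at x) \<and> D < 0"
      using w q that Fpos[of "q * x"] S[of x] by (intro exI[of _ "- (w * exp (- x) * F (q * x))"]) auto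
  qed
  have S_le: "S y \<le> S 0" if "0 \<le> y" for y
  proof (rule DERIV_nonpos_imp_nonincreasing[OF that])
    fix x :: real assume "0 \<le> x"
    then show "\<exists>D. (S has_real_derivative D) (at x) \<and> D \<le> 0"
      using w q Fpos[of "q * x"] S[of x] by (intro exI[of _ "- (w * exp (- x) * F (q * x))"]) auto
  qed
  have F_le: "F y \<le> F 0 + w * S 0" if "0 \<le> y" for y
  proof -
    \<comment> \<open>The added term is an antiderivative of minus the bound on F', so the sum is
      nonincreasing.\<close>
    have "F y + w * S 0 * exp (- y) \<le> F 0 + w * S 0 * exp (- 0)"
    proof (rule DERIV_nonpos_imp_nonincreasing[OF that])
      fix x :: real assume x: "0 \<le> x"
      have "((\<lambda>y. F y + w * S 0 * exp (- y)) has_real_derivative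
          w * exp (- x) * (S (q * x) - S 0)) (at x)"
        by (auto intro!: derivative_eq_intros F simp: algebra_simps)
      moreover have "w * exp (- x) * (S (q * x) - S 0) \<le> 0"
        using w q x S_le[of "q * x"] by (intro mult_nonneg_nonpos) auto
      ultimately show "\<exists>D. ((\<lambda>y. F y + w * S 0 * exp (- y)) has_real_derivative D) (at x) \<and> D \<le> 0"
        by blast
    qed
    moreover have "0 \<le> w * S 0 * exp (- y)"
      using w Spos[of 0] by simp
    ultimately show ?thesis by simp
  qed
  let ?h = "eigenfunction t q F S"
  have h_nonneg: "0 < ?h x" for x
    using Fpos[of "q * x"] Spos[of "- q * x"] q t0 by (auto simp: eigenfunction_def mult_nonneg_nonpos)
  have h_c: "c \<le> ?h x" if "0 \<le> x" for x
    using that q by (auto simp: eigenfunction_def intro!: Fc)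
  have eigen: "survival_op (asym_laplace \<xi>) (- q) (\<lambda>y. ennreal (?h y)) x = ennreal ?l * ennreal (?h x)" for x
    by (rule survival_op_eigenfunction[OF F S lim S0 Fpos Spos xi t l(1) w q])
  show ?thesis
  proof (rule persistence_rate[where h = "\<lambda>x. ennreal (?h x)" and B = "max (F 0 + w * S 0) (S 0 / t)"
        and C = "max (1 / c) (?l / c)", OF _ sets_asym_laplace _ _ _ eigen _ _ _ _ p p_eq])
    show "(\<lambda>x. ennreal (?h x)) \<in> borel_measurable borel"
      unfolding eigenfunction_def by measurable
    show "ennreal (?h x) \<le> ennreal (max (F 0 + w * S 0) (S 0 / t))" for x
    proof (intro ennreal_leI)
      show "?h x \<le> max (F 0 + w * S 0) (S 0 / t)"
      proof (cases "x < 0")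
        case True
        then show ?thesis using S_le[of "- q * x"] t0 q
          by (simp add: eigenfunction_def mult_nonneg_nonpos divide_right_mono le_max_iff_disj)
      next
        case False
        then show ?thesis using F_le[of "q * x"] q by (simp add: eigenfunction_def le_max_iff_disj)
      qed
    qed
    \<comment> \<open>On x >= 0 the eigenfunction is at least c, and the operator maps 1 to at most
      1. For x < 0 the surviving y are positive, where 1 <= h / c, so the eigenvalue equation gives
      the bound (l / c) h x even though h x may be small.\<close>
    show "survival_op (asym_laplace \<xi>) (- q) (\<lambda>_. 1) x \<le> ennreal (max (1 / c) (?l / c)) * ennreal (?h x)" for x
    proof (cases "x < 0")
      case True
      then have a: "0 \<le> - q * x" using q by (simp add: mult_nonneg_nonpos)
      have "survival_op (asym_laplace \<xi>) (- q) (\<lambda>_. 1) x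
          \<le> survival_op (asym_laplace \<xi>) (- q) (\<lambda>y. ennreal (1 / c) * ennreal (?h y)) x"
        unfolding survival_op_def
      proof (rule nn_integral_mono)
        fix y
        show "1 * indicator {- q * x<..} y \<le> ennreal (1 / c) * ennreal (?h y) * (indicator {- q * x<..} y :: ennreal)"
          using a c h_c[of y] by (auto simp: indicator_def field_simps simp flip: ennreal_mult' ennreal_1)
      qed
      also have "\<dots> = ennreal (1 / c) * (ennreal ?l * ennreal (?h x))"
        unfolding eigen[symmetric] by (intro survival_op_cmult) (auto simp: eigenfunction_def)
      also have "\<dots> = ennreal (1 / c * ?l) * ennreal (?h x)"
        using c l(2) by (subst ennreal_mult) (auto simp: mult.assoc)
      also have "\<dots> \<le> ennreal (max (1 / c) (?l / c)) * ennreal (?h x)"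
        by (intro mult_right_mono ennreal_leI) (auto simp: mult.commute)
      finally show ?thesis .
    next
      case False
      have "survival_op (asym_laplace \<xi>) (- q) (\<lambda>_. 1) x \<le> (\<integral>\<^sup>+ y. 1 \<partial>asym_laplace \<xi>)"
        unfolding survival_op_def by (intro nn_integral_mono) (auto simp: indicator_def)
      also have "\<dots> = 1" by (simp add: emeasure_space_1)
      also have "1 \<le> ennreal (1 / c) * ennreal (?h x)"
        using c h_c[of x] False by (auto simp: field_simps simp flip: ennreal_mult' ennreal_1)
      also have "\<dots> \<le> ennreal (max (1 / c) (?l / c)) * ennreal (?h x)"
        by (intro mult_right_mono ennreal_leI) auto
      finally show ?thesis .
    qed
    show "0 < ennreal (?h x)" for x
      using h_nonneg by simp
    show "0 < max (F 0 + w * S 0) (S 0 / t)" "0 < max (1 / c) (?l / c)"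
      using Spos[of 0] t0 c by (simp_all add: less_max_iff_disj)
  qed (fact \<open>prob_space (asym_laplace \<xi>)\<close> l(2))+
qed


subsection \<open>Poisson means\<close>

text \<open>For b y >= 0 this is the expectation of c N with N Poisson of mean b y. For bounded c
  the series form is also defined and differentiable at negative y.\<close>

definition poisson_mean :: "real \<Rightarrow> (nat \<Rightarrow> real) \<Rightarrow> real \<Rightarrow> real" where
  "poisson_mean b c y = exp (- (b * y)) * (\<Sum>m. c m / fact m * (b * y) ^ m)"

lemma summable_egf:
  fixes c :: "nat \<Rightarrow> real"
  assumes "\<And>m. \<bar>c m\<bar> \<le> K"
  shows "summable (\<lambda>m. c m / fact m * x ^ m)"
proof (rule summable_comparison_test')
  show "summable (\<lambda>m. K * (inverse (fact m) * \<bar>x\<bar> ^ m))"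
    by (intro summable_mult summable_exp)
  show "norm (c m / fact m * x ^ m) \<le> K * (inverse (fact m) * \<bar>x\<bar> ^ m)" for m
    using assms[of m] by (simp add: abs_mult power_abs divide_simps mult_right_mono)
qed

text \<open>Differentiating the series shifts the sequence, and differentiating the exponential
  subtracts it. Differential equations for the mean thus become difference equations for c.\<close>

lemma poisson_mean_has_real_derivative:
  assumes "\<And>m. \<bar>c m\<bar> \<le> K"
  shows "(poisson_mean b c has_real_derivative b * poisson_mean b (\<lambda>m. c (Suc m) - c m) y) (at y)"
proof -
  have diffs: "diffs (\<lambda>m. c m / fact m) = (\<lambda>m. c (Suc m) / fact m)"
  proof
    fix m
    have "real (Suc m) / fact (Suc m) = 1 / fact m" by (simp add: divide_simps)
    then show "diffs (\<lambda>m. c m / fact m) m = c (Suc m) / fact m"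
      by (simp add: diffs_def divide_simps)
  qed
  have "((\<lambda>x. \<Sum>m. c m / fact m * x ^ m) has_real_derivative (\<Sum>m. c (Suc m) / fact m * x ^ m)) (at x)" for x
    using termdiffs_strong_converges_everywhere[of "\<lambda>m. c m / fact m" x, OF summable_egf[OF assms]]
    unfolding diffs .
  then have "((\<lambda>y. \<Sum>m. c m / fact m * (b * y) ^ m) has_real_derivative (\<Sum>m. c (Suc m) / fact m * (b * y) ^ m) * b) (at y)"
    by (rule DERIV_chain2) (auto intro!: derivative_eq_intros)
  then have "(poisson_mean b c has_real_derivative
      b * (exp (- (b * y)) * ((\<Sum>m. c (Suc m) / fact m * (b * y) ^ m) - (\<Sum>m. c m / fact m * (b * y) ^ m)))) (at y)"
    unfolding poisson_mean_def[abs_def]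
    by (auto intro!: derivative_eq_intros simp: algebra_simps)
  also have "(\<Sum>m. c (Suc m) / fact m * (b * y) ^ m) - (\<Sum>m. c m / fact m * (b * y) ^ m)
      = (\<Sum>m. (c (Suc m) - c m) / fact m * (b * y) ^ m)"
    by (subst suminf_diff[OF summable_egf[OF assms] summable_egf[OF assms]])
       (simp only: diff_divide_distrib left_diff_distrib)
  finally show ?thesis by (simp only: poisson_mean_def[abs_def])
qed

text \<open>The weight q^m is absorbed into the m-th power of the series variable, and the
  exponential factor restores the normalisation. This is the origin of the dilated argument q y in
  the eigenvalue system.\<close>

lemma poisson_mean_geometric:
  "poisson_mean b (\<lambda>m. r * q ^ m * c m) y = r * exp (- (b * y) + b * (q * y)) * poisson_mean b c (q * y)"
  if "\<And>m. \<bar>c m\<bar> \<le> K"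
proof -
  have "(\<Sum>m. r * q ^ m * c m / fact m * (b * y) ^ m) = (\<Sum>m. r * (c m / fact m * (b * (q * y)) ^ m))"
    by (simp add: power_mult_distrib mult_ac)
  also have "\<dots> = r * (\<Sum>m. c m / fact m * (b * (q * y)) ^ m)"
    by (rule suminf_mult[OF summable_egf[OF that]])
  finally have "(\<Sum>m. r * q ^ m * c m / fact m * (b * y) ^ m) = r * (\<Sum>m. c m / fact m * (b * (q * y)) ^ m)" .
  moreover have "exp (- (b * y)) = exp (- (b * y) + b * (q * y)) * exp (- (b * (q * y)))"
    by (simp flip: exp_add)
  ultimately show ?thesis by (simp add: poisson_mean_def)
qed

lemma poisson_mean_const: "poisson_mean b (\<lambda>_. c) y = c"
proof -
  have "(\<lambda>m. c * ((b * y) ^ m /\<^sub>R fact m)) sums (c * exp (b * y))"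
    by (intro sums_mult exp_converges)
  then have "(\<Sum>m. c / fact m * (b * y) ^ m) = c * exp (b * y)"
    by (simp add: sums_iff field_simps)
  then show ?thesis by (simp add: poisson_mean_def exp_minus)
qed

lemma poisson_mean_mono:
  assumes "\<And>m. c m \<le> d m" "\<And>m. \<bar>c m\<bar> \<le> K" "\<And>m. \<bar>d m\<bar> \<le> L" "0 \<le> b * y"
  shows "poisson_mean b c y \<le> poisson_mean b d y"
  unfolding poisson_mean_def using assms
  by (intro mult_left_mono suminf_le summable_egf mult_right_mono divide_right_mono) auto

lemma poisson_mean_0: "poisson_mean b c 0 = c 0"
  using powser_zero[of "\<lambda>m. c m / fact m"] by (simp add: poisson_mean_def)


subsection \<open>The q-exponential on the imaginary axis\<close>

text \<open>The recursion of the q-factorial says that the term of index n + 1 times 1 - q^(n+1) is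
  (1 - q) z times the term of index n. Summing over n compares the series at z and at q z.\<close>

lemma qexp_functional_eq_disc:
  assumes q: "0 < q" "q < 1" and z: "norm z < 1 / (1 - q)"
  shows "qexp q (of_real q * z) = (1 - (1 - of_real q) * z) * qexp q z"
proof -
  have qz: "norm (of_real q * z) < 1 / (1 - q)"
    using q z mult_left_le_one_le[of "norm z" q] by (simp add: norm_mult)
  let ?a = "\<lambda>n. z ^ n / of_real (qfact q n)"
  have 1: "?a sums qexp q z"
    using q z by (intro qexp_sums) auto
  have "(\<lambda>n. (of_real q * z) ^ n / of_real (qfact q n)) sums qexp q (of_real q * z)"
    using q qz by (intro qexp_sums) auto
  from sums_diff[OF 1 this] have "(\<lambda>n. (1 - of_real q ^ n) * ?a n) sums (qexp q z - qexp q (of_real q * z))"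
    by (simp add: power_mult_distrib left_diff_distrib diff_divide_distrib)
  \<comment> \<open>The term of index 0 has the factor 1 - 1, so dropping it leaves the sum
    unchanged.\<close>
  then have "(\<lambda>n. (1 - of_real q ^ Suc n) * ?a (Suc n)) sums (qexp q z - qexp q (of_real q * z))"
    by (subst sums_Suc_iff) simp
  moreover have "(1 - of_real q ^ Suc n) * ?a (Suc n) = (1 - of_real q) * z * ?a n" for n
  proof -
    have "q ^ Suc n < 1" using q power_Suc_less_one by blast
    then have "(1 - of_real q ^ Suc n :: complex) \<noteq> 0"
      by (metis eq_iff_diff_eq_0 less_irrefl of_real_eq_1_iff of_real_power)
    moreover have "(of_real (qfact q (Suc n)) :: complex) = of_real (qfact q n) * ((1 - of_real q ^ Suc n) / (1 - of_real q))"
      using q by (simp add: qfact_def)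
    moreover have "(1 - of_real q :: complex) \<noteq> 0"
      using q by (metis eq_iff_diff_eq_0 less_irrefl of_real_eq_1_iff)
    moreover have "x * (z ^ Suc n / (f * (x / d))) = d * z * (z ^ n / f)" if "x \<noteq> 0" "d \<noteq> 0" for x d f :: complex
      using that by simp
    ultimately show ?thesis by metis
  qed
  ultimately have "(\<lambda>n. (1 - of_real q) * z * ?a n) sums (qexp q z - qexp q (of_real q * z))"
    by simp
  from sums_unique2[OF this sums_mult[OF 1]] show ?thesis
    by (simp add: algebra_simps)
qed

lemma qexp_tendsto_1:
  assumes q: "0 < q" "q < 1" and z: "norm z < 1 / (1 - q)"
  shows "(\<lambda>n. qexp q (of_real q ^ n * z)) \<longlonglongrightarrow> 1"
proof -
  let ?e = "\<lambda>u. \<Sum>n. 1 / of_real (qfact q n) * u ^ n :: complex"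
  obtain K where K: "0 < K" "K < 1 / (1 - q)"
    using dense[of 0 "1 / (1 - q)"] q by auto
  have sums: "(\<lambda>n. 1 / of_real (qfact q n) * u ^ n) sums qexp q u" if "norm u < 1 / (1 - q)" for u
    using qexp_sums[of q u] q that by simp
  have "isCont ?e 0"
    using K sums[of "of_real K"] by (intro isCont_powser[of _ "of_real K"]) (auto simp: sums_iff)
  moreover have "(\<lambda>n. of_real q ^ n * z) \<longlonglongrightarrow> 0 * z"
    using q by (intro tendsto_mult tendsto_const LIMSEQ_power_zero) simp
  ultimately have "(\<lambda>n. ?e (of_real q ^ n * z)) \<longlonglongrightarrow> ?e 0"
    using isCont_tendsto_compose[of 0 ?e] by simp
  moreover have "?e 0 = 1"
    using powser_zero[of "\<lambda>n. 1 / of_real (qfact q n) :: complex"] by (simp add: qfact_def)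
  moreover have "?e (of_real q ^ n * z) = qexp q (of_real q ^ n * z)" for n
  proof -
    have "norm (of_real q ^ n * z) \<le> norm z"
      using q by (simp add: norm_mult norm_power mult_left_le_one_le power_le_one)
    then show ?thesis using sums[of "of_real q ^ n * z"] z by (simp add: sums_iff)
  qed
  ultimately show ?thesis by simp
qed

text \<open>Merges the two branches of \<open>qexp\<close>. Inside the disc, n applications of the
  functional equation express the value at q^n z through the first n factors, and that value tends
  to 1. Outside, the product is the definition, and absolute convergence with nonzero factors
  remains to be checked.\<close>

lemma qexp_product:
  assumes q: "0 < q" "q < 1" and nz: "\<And>j. 1 - (1 - of_real q) * z * of_real q ^ j \<noteq> 0"
  shows "(\<lambda>n. \<Prod>j<n. 1 / (1 - (1 - of_real q) * z * of_real q ^ j)) \<longlonglongrightarrow> qexp q z" and "qexp q z \<noteq> 0"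
proof -
  let ?f = "\<lambda>j. 1 - (1 - of_real q) * z * of_real q ^ j"
  have "(\<lambda>n. \<Prod>j<n. 1 / ?f j) \<longlonglongrightarrow> qexp q z \<and> qexp q z \<noteq> 0"
  proof (cases "norm z < 1 / (1 - q)")
    case True
    have step: "qexp q (of_real q ^ n * z) = (\<Prod>j<n. ?f j) * qexp q z" for n
    proof (induction n)
      case (Suc n)
      have "norm (of_real q ^ n * z) \<le> norm z"
        using q by (simp add: norm_mult norm_power mult_left_le_one_le power_le_one)
      then have "qexp q (of_real q * (of_real q ^ n * z)) = ?f n * qexp q (of_real q ^ n * z)"
        using True by (subst qexp_functional_eq_disc[OF q]) (auto simp: mult_ac)
      then show ?case using Suc by (simp add: mult_ac)
    qed simp
    have lim: "(\<lambda>n. (\<Prod>j<n. ?f j) * qexp q z) \<longlonglongrightarrow> 1"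
      using qexp_tendsto_1[OF q True] unfolding step .
    then have ne: "qexp q z \<noteq> 0"
      using LIMSEQ_unique[OF _ tendsto_const] by fastforce
    have "(\<lambda>n. qexp q z / ((\<Prod>j<n. ?f j) * qexp q z)) \<longlonglongrightarrow> qexp q z / 1"
      by (intro tendsto_divide tendsto_const lim) simp
    then show ?thesis using ne by (simp add: prod_dividef)
  next
    case False
    have "summable (\<lambda>j. norm ((1 - of_real q) * z) * q ^ j)"
      using q by (intro summable_mult summable_geometric) auto
    then have "summable (\<lambda>j. norm (?f j - 1))"
      using q by (simp add: norm_mult norm_power mult_ac)
    then have "convergent_prod ?f"
      by (intro abs_convergent_prod_imp_convergent_prod summable_imp_abs_convergent_prod)
    then have conv: "convergent_prod (\<lambda>j. 1 / ?f j)"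
      using convergent_prod_inverse by (simp add: inverse_eq_divide)
    have e: "qexp q z = (\<Prod>j. 1 / ?f j)"
      using False q by (simp add: qexp_def)
    show ?thesis unfolding e
    proof
      show "(\<lambda>n. \<Prod>j<n. 1 / ?f j) \<longlonglongrightarrow> (\<Prod>j. 1 / ?f j)"
        by (rule has_prod_imp_tendsto'[OF convergent_prod_has_prod[OF conv]])
      show "(\<Prod>j. 1 / ?f j) \<noteq> 0"
        using nz by (intro prodinf_nonzero[OF conv]) simp
    qed
  qed
  then show "(\<lambda>n. \<Prod>j<n. 1 / ?f j) \<longlonglongrightarrow> qexp q z" "qexp q z \<noteq> 0" by auto
qed

lemma one_minus_imaginary_nonzero: "1 - (1 - of_real q) * (\<i> * of_real x) * of_real q ^ j \<noteq> 0"
proof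
  assume "1 - (1 - of_real q) * (\<i> * of_real x) * of_real q ^ j = 0"
  moreover have "Re (1 - (1 - of_real q) * (\<i> * of_real x) * of_real q ^ j) = 1"
    by (simp add: complex_eq_iff flip: of_real_power)
  ultimately show False by simp
qed

text \<open>Passing from x to x q deletes the factor j = 0 of the product. The argument is
  insensitive to the radius of convergence, which may separate the two points.\<close>

lemma qexp_imaginary_functional_eq:
  assumes q: "0 < q" "q < 1"
  shows "qexp q (\<i> * of_real (x * q)) = (1 - (1 - of_real q) * (\<i> * of_real x)) * qexp q (\<i> * of_real x)"
proof -
  let ?f = "\<lambda>x j. 1 - (1 - of_real q) * (\<i> * of_real x) * of_real q ^ j"
  have lim: "(\<lambda>n. \<Prod>j<n. 1 / ?f y j) \<longlonglongrightarrow> qexp q (\<i> * of_real y)" for y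
    by (intro qexp_product q one_minus_imaginary_nonzero)
  have "(\<lambda>n. ?f x 0 * (\<Prod>j<Suc n. 1 / ?f x j)) \<longlonglongrightarrow> ?f x 0 * qexp q (\<i> * of_real x)"
    by (intro tendsto_mult tendsto_const LIMSEQ_Suc[OF lim])
  also have "(\<lambda>n. ?f x 0 * (\<Prod>j<Suc n. 1 / ?f x j)) = (\<lambda>n. \<Prod>j<n. 1 / ?f (x * q) j)"
    using one_minus_imaginary_nonzero[of q x 0] unfolding prod.lessThan_Suc_shift
    by (simp add: mult_ac)
  finally show ?thesis
    using LIMSEQ_unique[OF lim[of "x * q"]] by simp
qed

section \<open>Argument of the q-exponential and inversion of the q-tangent\<close>

lemma abs_arctan_diff_le: "\<bar>arctan x - arctan y\<bar> \<le> \<bar>x - y\<bar>"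
proof -
  have "norm (arctan x - arctan y) \<le> 1 * norm (x - y)"
    by (rule field_differentiable_bound[of UNIV arctan "\<lambda>x. inverse (1 + x\<^sup>2)"])
       (auto intro!: derivative_eq_intros simp: inverse_le_1_iff)
  then show ?thesis by simp
qed

text \<open>The argument of \<open>e\<^sub>q (i x)\<close>, continued past \<open>\<pi>\<close>, read off from the product formula.\<close>
definition qarg :: "real \<Rightarrow> real \<Rightarrow> real" where
  "qarg q x = (\<Sum>j. arctan ((1 - q) * x * q ^ j))"

context
  fixes q :: real
  assumes q: "0 < q" "q < 1"
begin

text \<open>Since the arguments of the arctangents in \<open>qarg\<close> sum to x, termwise
  comparison yields Lipschitz constant 1.\<close>

lemma geometric_weights_sums: "(\<lambda>j. (1 - q) * x * q ^ j) sums x"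
  using sums_mult[OF geometric_sums[of q], of "(1 - q) * x"] q by simp

lemma qarg_sums: "(\<lambda>j. arctan ((1 - q) * x * q ^ j)) sums qarg q x"
proof -
  have "summable (\<lambda>j. arctan ((1 - q) * x * q ^ j))"
  proof (rule summable_comparison_test')
    show "summable (\<lambda>j. (1 - q) * \<bar>x\<bar> * q ^ j)"
      using geometric_weights_sums sums_iff by blast
    show "norm (arctan ((1 - q) * x * q ^ j)) \<le> (1 - q) * \<bar>x\<bar> * q ^ j" for j
      using abs_arctan_diff_le[of "(1 - q) * x * q ^ j" 0] q by (simp add: abs_mult)
  qed
  then show ?thesis unfolding qarg_def by (rule summable_sums)
qed

lemma qarg_0 [simp]: "qarg q 0 = 0"
  by (simp add: qarg_def)

lemma qarg_lipschitz: "x \<le> y \<Longrightarrow> qarg q y - qarg q x \<le> y - x"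
proof (rule sums_le[OF _ sums_diff[OF qarg_sums qarg_sums] sums_diff[OF geometric_weights_sums geometric_weights_sums]])
  fix j assume "x \<le> y"
  then have "(1 - q) * x * q ^ j \<le> (1 - q) * y * q ^ j"
    using q by (intro mult_right_mono mult_left_mono) auto
  then show "arctan ((1 - q) * y * q ^ j) - arctan ((1 - q) * x * q ^ j) \<le> (1 - q) * y * q ^ j - (1 - q) * x * q ^ j"
    using abs_arctan_diff_le[of "(1 - q) * y * q ^ j" "(1 - q) * x * q ^ j"] by simp
qed

lemma qarg_strict_mono:
  assumes "x < y"
  shows "qarg q x < qarg q y"
proof -
  have diff: "(\<lambda>j. arctan ((1 - q) * y * q ^ j) - arctan ((1 - q) * x * q ^ j)) sums (qarg q y - qarg q x)"
    by (intro sums_diff qarg_sums)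
  have "0 < (\<Sum>j. arctan ((1 - q) * y * q ^ j) - arctan ((1 - q) * x * q ^ j))"
    using assms q by (intro suminf_pos sums_summable[OF diff]) (simp add: arctan_less_iff)
  then show ?thesis using diff by (simp add: sums_iff)
qed

lemma qarg_less_iff: "qarg q x < qarg q y \<longleftrightarrow> x < y"
  by (metis less_asym linorder_less_linear qarg_strict_mono)

lemma isCont_qarg: "isCont (qarg q) x"
proof -
  have "1-lipschitz_on UNIV (qarg q)"
  proof (rule lipschitz_onI)
    fix x y
    show "dist (qarg q x) (qarg q y) \<le> 1 * dist x y"
      using qarg_lipschitz[of x y] qarg_lipschitz[of y x] qarg_less_iff[of x y] qarg_less_iff[of y x]
      by (cases x y rule: linorder_cases) (auto simp: dist_real_def)
  qed simp
  then show ?thesis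
    by (meson continuous_on_eq_continuous_at iso_tuple_UNIV_I lipschitz_on_continuous_on open_UNIV)
qed

lemma qarg_surj:
  assumes "0 \<le> a" "a \<le> pi / 2"
  obtains x where "0 \<le> x" "qarg q x = a"
proof -
  \<comment> \<open>Chosen so that the first two terms are arctan (1 / q) and arctan 1, each at
    least pi / 4.\<close>
  let ?x = "1 / ((1 - q) * q)"
  have "(\<Sum>j<2. arctan ((1 - q) * ?x * q ^ j)) \<le> qarg q ?x"
    unfolding qarg_def using q by (intro sum_le_suminf sums_summable[OF qarg_sums]) auto
  moreover have "arctan 1 \<le> arctan (1 / q)"
    using q by (simp only: arctan_le_iff) simp
  ultimately have "pi / 2 \<le> qarg q ?x"
    using q by (simp add: numeral_2_eq_2 arctan_one)
  then have "\<exists>x\<ge>0. x \<le> ?x \<and> qarg q x = a"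
    using assms q by (intro IVT) (auto intro: isCont_qarg)
  then show thesis using that by blast
qed

text \<open>A factor 1 / (1 - i y) has modulus 1 / sqrt (1 + y^2) <= 1 and argument arctan y. Moduli
  multiply, arguments add, and both pass to the limit; replacing x by -x conjugates every
  factor.\<close>

lemma qexp_imaginary_polar:
  "qexp q (\<i> * of_real x) = of_real (norm (qexp q (\<i> * of_real x))) * cis (qarg q x)"
  and norm_qexp_imaginary_pos: "0 < norm (qexp q (\<i> * of_real x))"
  and norm_qexp_imaginary_le_1: "norm (qexp q (\<i> * of_real x)) \<le> 1"
  and qexp_imaginary_cnj: "qexp q (- \<i> * of_real x) = cnj (qexp q (\<i> * of_real x))"
proof -
  let ?P = "\<lambda>x n. \<Prod>j<n. 1 / (1 - (1 - of_real q) * (\<i> * of_real x) * of_real q ^ j)"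
  have lim: "?P x \<longlonglongrightarrow> qexp q (\<i> * of_real x)" and nz: "qexp q (\<i> * of_real x) \<noteq> 0" for x
    by (intro qexp_product q one_minus_imaginary_nonzero)+
  have factor: "1 / (1 - (1 - of_real q) * (\<i> * of_real x) * of_real q ^ j)
      = of_real (1 / sqrt (1 + ((1 - q) * x * q ^ j)\<^sup>2)) * cis (arctan ((1 - q) * x * q ^ j))" for j
  proof -
    define y where "y = (1 - q) * x * q ^ j"
    define r where "r = 1 / sqrt (1 + y\<^sup>2)"
    have "0 < 1 + y\<^sup>2" by (simp add: add_pos_nonneg)
    then have r: "r * r * (1 + y\<^sup>2) = 1"
      by (simp add: r_def)
    have "cis (arctan y) = of_real r * (1 + \<i> * of_real y)"
      by (simp add: r_def complex_eq_iff cos_arctan sin_arctan)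
    then have "of_real r * cis (arctan y) * (1 - \<i> * of_real y)
        = of_real (r * r) * ((1 + \<i> * of_real y) * (1 - \<i> * of_real y))"
      by simp
    also have "(1 + \<i> * of_real y) * (1 - \<i> * of_real y) = of_real (1 + y\<^sup>2)"
      by (simp add: complex_eq_iff power2_eq_square)
    also have "of_real (r * r) * of_real (1 + y\<^sup>2) = (1 :: complex)"
      using r by (simp only: of_real_mult[symmetric] of_real_1)
    finally have "of_real r * cis (arctan y) * (1 - \<i> * of_real y) = 1" .
    moreover have "(1 - of_real q) * (\<i> * of_real x) * of_real q ^ j = \<i> * of_real y"
      by (simp add: y_def mult_ac)
    ultimately show ?thesis
      unfolding y_def[symmetric] r_def by (metis mult_zero_right nonzero_eq_divide_eq zero_neq_one)
  qed
  define R where "R n = (\<Prod>j<n. 1 / sqrt (1 + ((1 - q) * x * q ^ j)\<^sup>2))" for n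
  have P: "?P x n = of_real (R n) * cis (\<Sum>j<n. arctan ((1 - q) * x * q ^ j))" for n
  proof -
    have "(\<Prod>j<n. cis (a j)) = cis (\<Sum>j<n. a j)" for a
      by (induction n) (simp_all add: cis_mult add.commute)
    then show ?thesis
      unfolding factor R_def by (simp only: prod.distrib of_real_prod)
  qed
  have R: "0 \<le> R n" "R n \<le> 1" for n
  proof -
    have "1 / sqrt (1 + a\<^sup>2) \<le> 1" for a
      by (rule divide_le_eq_1_pos[THEN iffD2]) (simp_all add: add_pos_nonneg)
    then show "0 \<le> R n" "R n \<le> 1"
      unfolding R_def by (auto intro!: prod_nonneg prod_le_1)
  qed
  have norm_P: "norm (?P x n) = R n" for n
    unfolding P using R by (simp add: norm_mult)
  have R_lim: "R \<longlonglongrightarrow> norm (qexp q (\<i> * of_real x))"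
    using tendsto_norm[OF lim[of x]] unfolding norm_P .
  have "(\<lambda>n. \<Sum>j<n. arctan ((1 - q) * x * q ^ j)) \<longlonglongrightarrow> qarg q x"
    using qarg_sums by (simp add: sums_def)
  then have "(\<lambda>n. of_real (R n) * cis (\<Sum>j<n. arctan ((1 - q) * x * q ^ j)))
      \<longlonglongrightarrow> of_real (norm (qexp q (\<i> * of_real x))) * cis (qarg q x)"
    unfolding cis_conv_exp by (intro tendsto_mult tendsto_of_real R_lim tendsto_exp tendsto_const)
  then show "qexp q (\<i> * of_real x) = of_real (norm (qexp q (\<i> * of_real x))) * cis (qarg q x)"
    using LIMSEQ_unique[OF lim[of x, unfolded P]] by blast
  show "0 < norm (qexp q (\<i> * of_real x))" using nz by simp
  show "norm (qexp q (\<i> * of_real x)) \<le> 1"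
    by (rule LIMSEQ_le_const2[OF R_lim]) (use R in blast)
  have "(\<lambda>n. cnj (?P x n)) \<longlonglongrightarrow> cnj (qexp q (\<i> * of_real x))"
    by (intro tendsto_cnj lim)
  also have "(\<lambda>n. cnj (?P x n)) = ?P (- x)" by simp
  finally show "qexp q (- \<i> * of_real x) = cnj (qexp q (\<i> * of_real x))"
    using LIMSEQ_unique[OF lim[of "- x"]] by simp
qed

lemma qcos_of_real: "qcos q (of_real x) = of_real (norm (qexp q (\<i> * of_real x)) * cos (qarg q x))"
proof -
  have "qcos q (of_real x) = of_real (Re (qexp q (\<i> * of_real x)))"
    unfolding qcos_def qexp_imaginary_cnj by (simp add: complex_add_cnj)
  also have "Re (qexp q (\<i> * of_real x)) = norm (qexp q (\<i> * of_real x)) * cos (qarg q x)"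
    using arg_cong[OF qexp_imaginary_polar[of x], of Re] by simp
  finally show ?thesis .
qed

lemma qsin_of_real: "qsin q (of_real x) = of_real (norm (qexp q (\<i> * of_real x)) * sin (qarg q x))"
proof -
  have "qsin q (of_real x) = of_real (Im (qexp q (\<i> * of_real x)))"
    unfolding qsin_def qexp_imaginary_cnj by (simp add: complex_eq_iff)
  also have "Im (qexp q (\<i> * of_real x)) = norm (qexp q (\<i> * of_real x)) * sin (qarg q x)"
    using arg_cong[OF qexp_imaginary_polar[of x], of Im] by simp
  finally show ?thesis .
qed

text \<open>The positive modulus cancels, so inverting the q-tangent reduces to inverting the
  increasing function \<open>qarg\<close>.\<close>

lemma qtan_of_real: "qtan q (of_real x) = of_real (tan (qarg q x))"
  using norm_qexp_imaginary_pos[of x]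
  by (simp add: qtan_def qcos_of_real qsin_of_real tan_def)

text \<open>As the modulus never vanishes, the first positive zero is where the increasing argument
  reaches pi / 2.\<close>

lemma qarg_qcos_zero: "qarg q (qcos_zero q) = pi / 2"
proof -
  obtain z where z: "0 \<le> z" "qarg q z = pi / 2"
    using qarg_surj[of "pi / 2"] by auto
  have "qcos_zero q = z"
    unfolding qcos_zero_def
  proof (rule Least_equality)
    show "0 < z \<and> qcos q (of_real z) = 0"
    proof
      show "0 < z" using z by (cases "z = 0") auto
      have "cos (qarg q z) = 0" unfolding z(2) by simp
      then show "qcos q (of_real z) = 0" by (simp add: qcos_of_real)
    qed
    show "z \<le> x" if "0 < x \<and> qcos q (of_real x) = 0" for x
    proof (rule ccontr)
      assume "\<not> z \<le> x"
      then have "qarg q x < pi / 2" "0 < qarg q x"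
        using that z qarg_less_iff[of x z] qarg_less_iff[of 0 x] by auto
      then have "0 < cos (qarg q x)" by (intro cos_gt_zero)
      then show False using that norm_qexp_imaginary_pos[of x] by (simp add: qcos_of_real)
    qed
  qed
  with z show ?thesis by simp
qed

lemma qarg_qarctan:
  assumes "0 < t"
  shows "0 < qarctan q t" and "qarg q (qarctan q t) = arctan t"
proof -
  obtain w where w: "0 \<le> w" "qarg q w = arctan t"
    using qarg_surj[of "arctan t"] assms arctan_ubound[of t] by (auto simp: less_imp_le)
  have range: "0 \<le> qarg q x \<and> qarg q x < pi / 2" if "x \<in> {0..<qcos_zero q}" for x
    using that qarg_less_iff[of x 0] qarg_less_iff[of x "qcos_zero q"] by (auto simp: qarg_qcos_zero)
  \<comment> \<open>\<open>the_inv_into\<close> is determined only through injectivity; on this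
    interval the argument stays in [0, pi / 2), where arctan undoes tan.\<close>
  have inj: "inj_on (\<lambda>x. qtan q (of_real x)) {0..<qcos_zero q}"
  proof (rule inj_onI)
    fix x y assume xy: "x \<in> {0..<qcos_zero q}" "y \<in> {0..<qcos_zero q}"
      and "qtan q (of_real x) = qtan q (of_real y)"
    then have "tan (qarg q x) = tan (qarg q y)" by (simp add: qtan_of_real)
    then have "arctan (tan (qarg q x)) = arctan (tan (qarg q y))" by simp
    then have "qarg q x = qarg q y"
      using range[OF xy(1)] range[OF xy(2)] by (simp add: arctan_tan)
    then show "x = y"
      using qarg_strict_mono by (metis less_irrefl linorder_less_linear)
  qed
  have "w < qcos_zero q"
    using qarg_less_iff[of w "qcos_zero q"] w arctan_ubound[of t] by (simp add: qarg_qcos_zero)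
  then have "qarctan q t = w"
    using w q the_inv_into_f_eq[OF inj, of w "of_real t"]
    by (simp add: qarctan_def qtan_of_real tan_arctan)
  moreover have "w \<noteq> 0" using w assms by auto
  ultimately show "0 < qarctan q t" "qarg q (qarctan q t) = arctan t"
    using w by auto
qed

end


subsection \<open>Solution of the eigenvalue equation\<close>

text \<open>Real and imaginary parts of the functional equation at w q^m give coupled difference
  equations for C and S, which Poisson means with b = 1 / (1 - q) turn into the differential system.
  All arguments at w q^m lie in [0, pi / 2), so S is nonnegative, C increases, and c = C 0 is a
  positive lower bound.\<close>

lemma eigenfunction_system_qtan:
  assumes q: "0 < q" "q < 1" and w: "0 < w" and tan: "qarg q w = arctan t" and t: "0 < t"
  obtains F S :: "real \<Rightarrow> real" and c where
    "\<And>y. (F has_real_derivative w * exp (- y) * S (q * y)) (at y)"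
    "\<And>y. (S has_real_derivative - (w * exp (- y) * F (q * y))) (at y)"
    "(S \<longlongrightarrow> 0) at_top" "S 0 = t * F 0" "0 < c" "\<And>y. 0 \<le> y \<Longrightarrow> c \<le> F y"
proof -
  define E where "E m = qexp q (\<i> * of_real (w * q ^ m))" for m
  define C where "C m = Re (E m)" for m
  define S where "S m = Im (E m)" for m
  let ?b = "1 / (1 - q)"
  have rec: "E (Suc m) = (1 - (1 - of_real q) * (\<i> * of_real (w * q ^ m))) * E m" for m
    using qexp_imaginary_functional_eq[OF q, of "w * q ^ m"] by (simp add: E_def mult_ac)
  have C_Suc: "C (Suc m) - C m = ((1 - q) * w) * q ^ m * S m"
    and S_Suc: "S (Suc m) - S m = (- (1 - q) * w) * q ^ m * C m" for m
    unfolding C_def S_def rec by (simp_all add: algebra_simps flip: of_real_power)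
  have norm_E: "norm (E m) \<le> 1" for m
    unfolding E_def by (rule norm_qexp_imaginary_le_1[OF q])
  have C_le: "\<bar>C m\<bar> \<le> 1" and S_le: "\<bar>S m\<bar> \<le> 1" for m
    using abs_Re_le_cmod[of "E m"] abs_Im_le_cmod[of "E m"] norm_E[of m] by (simp_all add: C_def S_def)
  have polar: "C m = norm (E m) * cos (qarg q (w * q ^ m))" "S m = norm (E m) * sin (qarg q (w * q ^ m))" for m
    using arg_cong[OF qexp_imaginary_polar[OF q, of "w * q ^ m"], of Re]
      arg_cong[OF qexp_imaginary_polar[OF q, of "w * q ^ m"], of Im]
    by (simp_all add: C_def S_def E_def)
  have arg: "0 \<le> qarg q (w * q ^ m)" "qarg q (w * q ^ m) \<le> w * q ^ m" "qarg q (w * q ^ m) < pi / 2" for m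
  proof -
    have m: "0 \<le> w * q ^ m" "w * q ^ m \<le> w" using w q by (auto simp: power_le_one mult_right_le_one_le)
    show "0 \<le> qarg q (w * q ^ m)"
      using m qarg_less_iff[OF q, of "w * q ^ m" 0] q by (simp add: qarg_0 not_less[symmetric])
    show "qarg q (w * q ^ m) \<le> w * q ^ m"
      using qarg_lipschitz[OF q m(1)] by (simp add: qarg_0[OF q])
    show "qarg q (w * q ^ m) < pi / 2"
      using m(2) qarg_less_iff[OF q, of w "w * q ^ m"] arctan_ubound[of t] tan by linarith
  qed
  have S_nonneg: "0 \<le> S m" for m
    unfolding polar using arg[of m] by (intro mult_nonneg_nonneg sin_ge_zero) auto
  \<comment> \<open>Geometric decay in m becomes exponential decay in y: the Poisson mean of w q^m
    is w exp (-y).\<close>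
  have S_geom: "S m \<le> w * q ^ m" for m
  proof -
    have "S m \<le> 1 * sin (qarg q (w * q ^ m))"
      unfolding polar using arg[of m] norm_E by (intro mult_right_mono sin_ge_zero) auto
    also have "\<dots> \<le> w * q ^ m"
      using sin_x_le_x[OF arg(1)[of m]] arg(2)[of m] by simp
    finally show ?thesis .
  qed
  have "0 < norm (E 0)" unfolding E_def by (rule norm_qexp_imaginary_pos[OF q])
  then have C0: "0 < C 0"
    unfolding polar using arg[of 0] pi_gt_zero by (intro mult_pos_pos cos_gt_zero_pi) linarith+
  have "incseq C"
  proof (rule incseq_SucI)
    fix m
    have "0 \<le> ((1 - q) * w) * q ^ m * S m" using q w S_nonneg by simp
    then show "C m \<le> C (Suc m)" using C_Suc[of m] by simp
  qed
  then have C_ge: "C 0 \<le> C m" for m by (rule incseqD) simp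
  have b: "?b * (1 - q) * w = w" "?b * (- (1 - q)) * w = - w" using q by (simp_all add: field_simps)
  have e: "- (?b * y) + ?b * (q * y) = - y" for y
  proof -
    have "- (?b * y) + ?b * (q * y) = - (?b * (1 - q) * y)" by (simp only: ring_distribs)
    then show ?thesis using q by simp
  qed
  show thesis
  proof
    show "(poisson_mean ?b C has_real_derivative w * exp (- y) * poisson_mean ?b S (q * y)) (at y)" for y
    proof -
      have "?b * poisson_mean ?b (\<lambda>m. C (Suc m) - C m) y = w * exp (- y) * poisson_mean ?b S (q * y)"
        unfolding C_Suc poisson_mean_geometric[OF S_le] e unfolding mult.assoc[symmetric] b ..
      then show ?thesis using poisson_mean_has_real_derivative[of C 1 ?b y, OF C_le] by simp
    qed
    show "(poisson_mean ?b S has_real_derivative - (w * exp (- y) * poisson_mean ?b C (q * y))) (at y)" for y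
    proof -
      have "?b * poisson_mean ?b (\<lambda>m. S (Suc m) - S m) y = - w * exp (- y) * poisson_mean ?b C (q * y)"
        unfolding S_Suc poisson_mean_geometric[OF C_le] e unfolding mult.assoc[symmetric] b ..
      then show ?thesis using poisson_mean_has_real_derivative[of S 1 ?b y, OF S_le] by simp
    qed
    show "(poisson_mean ?b S \<longlongrightarrow> 0) at_top"
    proof (rule tendsto_sandwich)
      have bpos: "0 \<le> ?b * y" if "0 \<le> y" for y using that q by simp
      \<comment> \<open>The factor 1 brings the sequence into the form of
        \<open>poisson_mean_geometric\<close> with a constant sequence.\<close>
      have le: "\<bar>w * q ^ m * 1\<bar> \<le> w" for m
        using w q by (simp add: abs_mult power_le_one mult_right_le_one_le)
      show "\<forall>\<^sub>F y in at_top. 0 \<le> poisson_mean ?b S y"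
        using eventually_ge_at_top[of 0]
      proof eventually_elim
        case (elim y)
        show ?case
          using poisson_mean_mono[of "\<lambda>_. 0" S 0 1 ?b y] S_nonneg S_le bpos[OF elim]
          by (simp add: poisson_mean_const)
      qed
      show "\<forall>\<^sub>F y in at_top. poisson_mean ?b S y \<le> w * exp (- y)"
        using eventually_ge_at_top[of 0]
      proof eventually_elim
        case (elim y)
        have "poisson_mean ?b S y \<le> poisson_mean ?b (\<lambda>m. w * q ^ m * 1) y"
          using S_geom by (intro poisson_mean_mono[OF _ S_le le bpos[OF elim]]) simp
        also have "\<dots> = w * exp (- y)"
          unfolding poisson_mean_geometric[of "\<lambda>_. 1" 1, OF order_eq_refl[OF abs_one]] e by (simp add: poisson_mean_const)
        finally show ?case .
      qed
      have "((\<lambda>y :: real. w * exp (- y)) \<longlongrightarrow> w * 0) at_top"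
        by (intro tendsto_mult tendsto_const filterlim_compose[OF exp_at_bot filterlim_uminus_at_bot_at_top])
      then show "((\<lambda>y. w * exp (- y)) \<longlongrightarrow> 0) at_top" by simp
    qed simp
    \<comment> \<open>At y = 0 a Poisson mean is its term of index 0, so the boundary condition is
      that the argument at w equals arctan t.\<close>
    have "sin (arctan t) = t * cos (arctan t)"
      by (simp add: sin_arctan cos_arctan)
    then show "poisson_mean ?b S 0 = t * poisson_mean ?b C 0"
      by (simp add: poisson_mean_0 polar tan)
    show "0 < C 0" by fact
    show "C 0 \<le> poisson_mean ?b C y" if "0 \<le> y" for y
      using poisson_mean_mono[of "\<lambda>_. C 0" C 1 1 ?b y] C_ge C_le that q
      by (simp add: poisson_mean_const)
  qed
qed

text \<open>Poisson means cover 0 < q < 1; both endpoints have closed-form solutions.\<close>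

lemma eigenfunction_system:
  assumes q: "0 \<le> q" "q \<le> 1" and t: "0 < t"
  defines "w \<equiv> qarctan q t"
  obtains F S :: "real \<Rightarrow> real" and c where
    "\<And>y. (F has_real_derivative w * exp (- y) * S (q * y)) (at y)"
    "\<And>y. (S has_real_derivative - (w * exp (- y) * F (q * y))) (at y)"
    "(S \<longlongrightarrow> 0) at_top" "S 0 = t * F 0" "0 < c" "\<And>y. 0 \<le> y \<Longrightarrow> c \<le> F y" "0 < w"
proof -
  have exp_lim: "((\<lambda>y :: real. exp (- y)) \<longlongrightarrow> 0) at_top"
    by (intro filterlim_compose[OF exp_at_bot filterlim_uminus_at_bot_at_top])
  consider "q = 0" | "0 < q" "q < 1" | "q = 1" using q by linarith
  then show thesis
  proof cases
    case 1
    then have w: "w = t" by (simp add: w_def qarctan_def)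
    \<comment> \<open>For q = 0 the right-hand sides contain only F 0 and S 0, so the system
      integrates directly, normalised by F 0 = 1.\<close>
    show thesis
    proof (rule that[of "\<lambda>y. 1 + t * t * (1 - exp (- y))" "\<lambda>y. t * exp (- y)" 1])
      show "((\<lambda>y. t * exp (- y)) \<longlongrightarrow> 0) at_top"
        using tendsto_mult[OF tendsto_const exp_lim, of t] by simp
    qed (use t in \<open>auto simp: w 1 intro!: derivative_eq_intros\<close>)
  next
    case 2
    then show thesis
      using eigenfunction_system_qtan[of q w t] qarg_qarctan[of q t] t that unfolding w_def by metis
  next
    case 3
    then have w: "w = arctan t" using t by (simp add: w_def qarctan_1)
    have "0 < w" "w < pi / 2" using t arctan_ubound by (auto simp: w)
    \<comment> \<open>For q = 1 the substitution u = w exp (-y) reduces the system to the one for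
      cos u and sin u, and u <= w < pi / 2 bounds the cosine below.\<close>
    show thesis
    proof (rule that[of "\<lambda>y. cos (w * exp (- y))" "\<lambda>y. sin (w * exp (- y))" "cos w"])
      have "((\<lambda>y. sin (w * exp (- y))) \<longlongrightarrow> sin (w * 0)) at_top"
        by (intro tendsto_intros exp_lim)
      then show "((\<lambda>y. sin (w * exp (- y))) \<longlongrightarrow> 0) at_top" by simp
      show "sin (w * exp (- 0)) = t * cos (w * exp (- 0))"
        by (simp add: w sin_arctan cos_arctan)
      show "0 < cos w" using \<open>0 < w\<close> \<open>w < pi / 2\<close> by (rule cos_gt_zero)
      show "cos w \<le> cos (w * exp (- y))" if "0 \<le> y" for y
        using \<open>0 < w\<close> \<open>w < pi / 2\<close> that by (intro cos_monotone_0_pi_le) (auto simp: mult_right_le_one_le)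
      show "((\<lambda>y. cos (w * exp (- y))) has_real_derivative w * exp (- y) * sin (w * exp (- (q * y)))) (at y)"
        and "((\<lambda>y. sin (w * exp (- y))) has_real_derivative - (w * exp (- y) * cos (w * exp (- (q * y))))) (at y)" for y
        unfolding 3 by (rule derivative_eq_intros refl | simp)+
      show "0 < w" by fact
    qed
  qed
qed

text \<open>Dividing X (k+1) > \<theta> X k by the negative \<theta> gives X k > (1 / \<theta>) X
  (k+1), the persistence condition for the reversed segment with parameter 1 / \<theta>. The
  reversed segment is again i.i.d. with the same law, so both probabilities equal the same iterated
  integral.\<close>

lemma persistence_prob_reverse:
  assumes "prob_space M" and indep: "prob_space.indep_vars M (\<lambda>_. borel) X UNIV"
    and distr: "\<And>i. distr M borel (X i) = \<mu>" and "\<theta> < 0"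
  shows "persistence_prob M X \<theta> n = persistence_prob M X (1 / \<theta>) n"
proof -
  interpret prob_space M by fact
  let ?Y = "X \<circ> (\<lambda>k. n - k)"
  have "indep_vars ((\<lambda>_. borel) \<circ> (\<lambda>k. n - k)) ?Y {..n}"
    by (rule indep_vars_reindex[OF indep]) (auto simp: inj_on_def)
  then have indep_Y: "indep_vars (\<lambda>_. borel) ?Y {..n}"
    by (simp only: o_def)
  have Y: "emeasure M {\<omega> \<in> space M. \<forall>k<n. ?Y (Suc k) \<omega> > 1 / \<theta> * ?Y k \<omega>}
      = (\<integral>\<^sup>+ x. (survival_op \<mu> (1 / \<theta>) ^^ n) (\<lambda>_. 1) x \<partial>\<mu>)"
    by (rule emeasure_persistence[OF assms(1) indep_Y]) (simp only: o_def distr)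
  have X: "emeasure M {\<omega> \<in> space M. \<forall>k<n. X (Suc k) \<omega> > 1 / \<theta> * X k \<omega>}
      = (\<integral>\<^sup>+ x. (survival_op \<mu> (1 / \<theta>) ^^ n) (\<lambda>_. 1) x \<partial>\<mu>)"
    by (rule emeasure_persistence[OF assms(1) indep_vars_subset[OF indep] distr]) simp
  have "(\<forall>k<n. ?Y (Suc k) \<omega> > 1 / \<theta> * ?Y k \<omega>) \<longleftrightarrow> (\<forall>k<n. X (Suc k) \<omega> > \<theta> * X k \<omega>)" for \<omega>
  proof -
    \<comment> \<open>The map k to n - Suc k is an involution of the indices below n.\<close>
    have reflect: "(\<forall>k<n. P k) \<longleftrightarrow> (\<forall>k<n. P (n - Suc k))" for P
    proof (intro iffI allI impI)
      fix k assume "\<forall>k<n. P (n - Suc k)" "k < n"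
      moreover from this have "n - Suc (n - Suc k) = k" "n - Suc k < n" by auto
      ultimately show "P k" by metis
    qed auto
    have "(\<forall>k<n. X (Suc k) \<omega> > \<theta> * X k \<omega>) \<longleftrightarrow> (\<forall>k<n. X (n - k) \<omega> > \<theta> * X (n - Suc k) \<omega>)"
      by (subst reflect) (auto simp: Suc_diff_Suc)
    also have "\<dots> \<longleftrightarrow> (\<forall>k<n. ?Y (Suc k) \<omega> > 1 / \<theta> * ?Y k \<omega>)"
      using \<open>\<theta> < 0\<close> by (simp add: field_simps)
    finally show ?thesis by blast
  qed
  with X Y show ?thesis
    unfolding persistence_prob_def measure_def by (simp only:)
qed

theorem corollary3:
  fixes M :: "'a measure" and X :: "nat \<Rightarrow> 'a \<Rightarrow> real" and \<xi> \<theta> :: real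
  assumes "prob_space M"
    and "prob_space.indep_vars M (\<lambda>_. borel) X UNIV"
    and "\<And>i. distributed M lborel (X i) (\<lambda>x. ennreal (asym_laplace_density \<xi> x))"
    and "0 < \<xi>" and "\<xi> < 1"
  shows "(-1 \<le> \<theta> \<and> \<theta> \<le> 0 \<longrightarrow>
           (\<lambda>n. 1 / real n * ln (persistence_prob M X \<theta> n))
             \<longlonglongrightarrow> ln (sqrt (\<xi> * (1 - \<xi>)) / qarctan (- \<theta>) (sqrt (\<xi> / (1 - \<xi>))))) \<and>
         (\<theta> < -1 \<longrightarrow>
           (\<lambda>n. 1 / real n * ln (persistence_prob M X \<theta> n))
             \<longlonglongrightarrow> ln (sqrt (\<xi> * (1 - \<xi>)) / qarctan (- 1 / \<theta>) (sqrt (\<xi> / (1 - \<xi>)))))"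
proof -
  interpret prob_space M by fact
  have distr: "distr M borel (X i) = asym_laplace \<xi>" for i
    using assms(3)[of i] unfolding distributed_def asym_laplace_def
    by (metis distr_cong sets_lborel)
  have "prob_space (asym_laplace \<xi>)"
    using prob_space_distr[of "X 0" borel] distributed_measurable[OF assms(3)[of 0]] distr[of 0] by simp
  \<comment> \<open>Used with q = -\<theta> in the first case and, after time reversal, with q = -1
    / \<theta> in the second.\<close>
  have main: "(\<lambda>n. 1 / real n * ln (persistence_prob M X (- q) n))
      \<longlonglongrightarrow> ln (sqrt (\<xi> * (1 - \<xi>)) / qarctan q (sqrt (\<xi> / (1 - \<xi>))))"
    if q: "0 \<le> q" "q \<le> 1" for q
  proof -
    have t: "0 < sqrt (\<xi> / (1 - \<xi>))" using assms by simp
    obtain F S c where FS: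
      "\<And>y. (F has_real_derivative qarctan q (sqrt (\<xi> / (1 - \<xi>))) * exp (- y) * S (q * y)) (at y)"
      "\<And>y. (S has_real_derivative - (qarctan q (sqrt (\<xi> / (1 - \<xi>))) * exp (- y) * F (q * y))) (at y)"
      "(S \<longlongrightarrow> 0) at_top" "S 0 = sqrt (\<xi> / (1 - \<xi>)) * F 0" "0 < c" "\<And>y. 0 \<le> y \<Longrightarrow> c \<le> F y"
      and w: "0 < qarctan q (sqrt (\<xi> / (1 - \<xi>)))"
      using eigenfunction_system[OF q t] by metis
    show ?thesis
    proof (rule persistence_rate_asym_laplace[OF FS assms(4,5) refl w q(1) \<open>prob_space (asym_laplace \<xi>)\<close>])
      show "ennreal (persistence_prob M X (- q) n)
          = (\<integral>\<^sup>+ x. (survival_op (asym_laplace \<xi>) (- q) ^^ n) (\<lambda>_. 1) x \<partial>asym_laplace \<xi>)" for n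
        unfolding persistence_prob_def emeasure_eq_measure[symmetric]
        by (rule emeasure_persistence[OF assms(1) indep_vars_subset[OF assms(2)] distr]) simp
      show "0 \<le> persistence_prob M X (- q) n" for n
        unfolding persistence_prob_def by (rule measure_nonneg)
    qed
  qed
  show ?thesis
  proof (intro conjI impI)
    assume "- 1 \<le> \<theta> \<and> \<theta> \<le> 0"
    then show "(\<lambda>n. 1 / real n * ln (persistence_prob M X \<theta> n))
        \<longlonglongrightarrow> ln (sqrt (\<xi> * (1 - \<xi>)) / qarctan (- \<theta>) (sqrt (\<xi> / (1 - \<xi>))))"
      using main[of "- \<theta>"] by simp
  next
    assume "\<theta> < - 1"
    then have "0 \<le> - 1 / \<theta>" "- 1 / \<theta> \<le> 1" by (auto simp: field_simps)
    moreover have "persistence_prob M X \<theta> n = persistence_prob M X (1 / \<theta>) n" for n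
      using \<open>\<theta> < - 1\<close> by (intro persistence_prob_reverse[OF assms(1,2) distr]) simp
    ultimately show "(\<lambda>n. 1 / real n * ln (persistence_prob M X \<theta> n))
        \<longlonglongrightarrow> ln (sqrt (\<xi> * (1 - \<xi>)) / qarctan (- 1 / \<theta>) (sqrt (\<xi> / (1 - \<xi>))))"
      using main[of "- 1 / \<theta>"] by simp
  qed
qed

end
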